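(* Fix $\lambda\in\mathbb C$. Then: 1. There exists a probability measure $\rho$ on $\mathbb R$, depending on $\lambda$, such that $$H_{11}(\lambda,\zeta)=\zeta+p\cdot\int_{\mathbb R}\frac{1}{\zeta-t}\,d\rho(t)\qquad\text{for all }\zeta\in\mathbb C^+.$$ 2. $\Re H_{11}(\lambda,\mathrm i\delta)=0$ for all $\delta\in(0,\infty)$. 3. The map $\delta\mapsto\dfrac{\Im H_{11}(\lambda,\mathrm i\delta)}{\delta}$ is continuous and strictly increasing on $(0,\infty)$, and $\lim_{\delta\to\infty}\dfrac{\Im H_{11}(\lambda,\mathrm i\delta)}{\delta}=1$.
   Context: $(\mathcal A,\varphi)$ is a $W^*$-probability space where $\varphi$ is a faithful trace; $x\in\mathcal A$ is selfadjoint, and $p\in(0,\infty)$ (the parameter of a free Poisson element $y\in\mathcal A$, freely independent of $x$). Let $E:M_2(\mathcal A)\to M_2(\mathbb C)$ apply $\varphi$ entrywise, $X=\begin{bmatrix}0 & x \\ x & 0\end{bmatrix}$, $J=\begin{bmatrix}0&\mathrm i\\-\mathrm i&0\end{bmatrix}$, and $\mathbb H_2^+=\{B\in M_2(\mathbb C):\Im B=\frac1{2\mathrm i}(B-B^* )\text{ is positive definite and invertible}\}$. Put $G_X(B)=E((B-X)^{-1})$ and $H(B)=B+p\,(J-G_X(B))^{-1}$ for $B\in\mathbb H_2^+$. For $\lambda\in\mathbb C$ and $\zeta\in\mathbb C^+$ (the open upper half plane), $B(\lambda,\zeta)=\begin{bmatrix}\zeta&\lambda\\ \bar\lambda&\zeta\end{bmatrix}$,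 and $H_{ij}(\lambda,\zeta)$ denotes the $(i,j)$-entry of $H(B(\lambda,\zeta))$. *)

theory Defs
  imports "HOL-Probability.Probability"
begin

section \<open>\<open>C\<^sup>*\<close>- and \<open>W\<^sup>*\<close>-algebras\<close>

text \<open>Unital complex \<open>C\<^sup>*\<close>-algebras. The real scalar multiplication, the norm and completeness
  come from the superclasses; \<open>cscale\<close> is the complex scalar multiplication extending \<open>scaleR\<close>.\<close>

class cstar_algebra = real_normed_algebra_1 + banach +
  fixes cscale :: "complex \<Rightarrow> 'a \<Rightarrow> 'a"
    and star :: "'a \<Rightarrow> 'a"
  assumes cscale_add_right: "cscale c (a + b) = cscale c a + cscale c b"
    and cscale_add_left: "cscale (c + d) a = cscale c a + cscale d a"
    and cscale_cscale: "cscale c (cscale d a) = cscale (c * d) a"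
    and cscale_of_real: "cscale (complex_of_real r) a = r *\<^sub>R a"
    and mult_cscale_left: "cscale c a * b = cscale c (a * b)"
    and mult_cscale_right: "a * cscale c b = cscale c (a * b)"
    and norm_cscale: "norm (cscale c a) = cmod c * norm a"
    and star_star: "star (star a) = a"
    and star_add: "star (a + b) = star a + star b"
    and star_mult: "star (a * b) = star b * star a"
    and star_cscale: "star (cscale c a) = cscale (cnj c) (star a)"
    and cstar_identity: "norm (star a * a) = (norm a)\<^sup>2"

definition selfadjoint :: "'a::cstar_algebra \<Rightarrow> bool" where
  "selfadjoint a \<longleftrightarrow> star a = a"

definition clinear_functional :: "('a::cstar_algebra \<Rightarrow> complex) \<Rightarrow> bool" where
  "clinear_functional f \<longleftrightarrow>
     (\<forall>a b. f (a + b) = f a + f b) \<and> (\<forall>c a. f (cscale c a) = c * f a)"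

definition bounded_clinear_functional :: "('a::cstar_algebra \<Rightarrow> complex) \<Rightarrow> bool" where
  "bounded_clinear_functional f \<longleftrightarrow> bounded_linear f \<and> clinear_functional f"

text \<open>A predual is represented inside the Banach space dual: a norm-closed space \<open>F\<close> of bounded
  functionals such that \<open>a \<mapsto> (f \<mapsto> f a)\<close> is an isometry of the algebra onto the dual of \<open>F\<close>.
  Every Banach space predual arises in this way from its canonical image in the dual.\<close>

definition is_predual :: "('a::cstar_algebra \<Rightarrow> complex) set \<Rightarrow> bool" where
  "is_predual F \<longleftrightarrow>
     (\<forall>f\<in>F. bounded_clinear_functional f) \<and>
     (\<lambda>a. 0) \<in> F \<and>
     (\<forall>f\<in>F. \<forall>g\<in>F. (\<lambda>a. f a + g a) \<in> F) \<and>
     (\<forall>c. \<forall>f\<in>F. (\<lambda>a. c * f a) \<in> F) \<and>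
     (\<forall>f. bounded_clinear_functional f \<longrightarrow>
        (\<forall>e>0. \<exists>g\<in>F. onorm (\<lambda>a. f a - g a) < e) \<longrightarrow> f \<in> F) \<and>
     (\<forall>a. norm a = (SUP f\<in>{f\<in>F. onorm f \<le> 1}. cmod (f a))) \<and>
     (\<forall>L :: ('a \<Rightarrow> complex) \<Rightarrow> complex.
        (\<forall>f\<in>F. \<forall>g\<in>F. L (\<lambda>a. f a + g a) = L f + L g) \<and>
        (\<forall>c. \<forall>f\<in>F. L (\<lambda>a. c * f a) = c * L f) \<and>
        (\<exists>K. \<forall>f\<in>F. cmod (L f) \<le> K * onorm f)
        \<longrightarrow> (\<exists>a. \<forall>f\<in>F. L f = f a))"

text \<open>Sakai's definition: a \<open>W\<^sup>*\<close>-algebra (abstract von Neumann algebra) is a \<open>C\<^sup>*\<close>-algebra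
  which is the dual of a Banach space.\<close>

definition is_wstar_algebra :: "'a::cstar_algebra itself \<Rightarrow> bool" where
  "is_wstar_algebra (_ :: 'a itself) \<longleftrightarrow> (\<exists>F :: ('a \<Rightarrow> complex) set. is_predual F)"

text \<open>The predual is unique, so that the normal functionals are exactly its elements.\<close>

definition normal_functional :: "('a::cstar_algebra \<Rightarrow> complex) \<Rightarrow> bool" where
  "normal_functional f \<longleftrightarrow> (\<exists>F. is_predual F \<and> f \<in> F)"


section \<open>Noncommutative probability\<close>

definition state :: "('a::cstar_algebra \<Rightarrow> complex) \<Rightarrow> bool" where
  "state \<phi> \<longleftrightarrow> clinear_functional \<phi> \<and> \<phi> 1 = 1 \<and> (\<forall>a. \<phi> (star a * a) \<in> \<real>\<^sub>\<ge>\<^sub>0)"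

definition faithful :: "('a::cstar_algebra \<Rightarrow> complex) \<Rightarrow> bool" where
  "faithful \<phi> \<longleftrightarrow> (\<forall>a. \<phi> (star a * a) = 0 \<longrightarrow> a = 0)"

definition tracial :: "('a::cstar_algebra \<Rightarrow> complex) \<Rightarrow> bool" where
  "tracial \<phi> \<longleftrightarrow> (\<forall>a b. \<phi> (a * b) = \<phi> (b * a))"

text \<open>A \<open>W\<^sup>*\<close>-probability space whose state is a faithful (normal) trace.\<close>

definition tracial_wstar_prob_space :: "('a::cstar_algebra \<Rightarrow> complex) \<Rightarrow> bool" where
  "tracial_wstar_prob_space \<phi> \<longleftrightarrow>
     is_wstar_algebra TYPE('a) \<and> state \<phi> \<and> normal_functional \<phi> \<and> faithful \<phi> \<and> tracial \<phi>"

definition unital_subalgebra :: "'a::cstar_algebra set \<Rightarrow> bool" where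
  "unital_subalgebra M \<longleftrightarrow>
     1 \<in> M \<and> (\<forall>a\<in>M. \<forall>b\<in>M. a + b \<in> M \<and> a * b \<in> M) \<and> (\<forall>c. \<forall>a\<in>M. cscale c a \<in> M)"

definition generated_algebra :: "'a::cstar_algebra set \<Rightarrow> 'a set" where
  "generated_algebra S = unital_subalgebra hull S"

definition free_subalgebras ::
    "('a::cstar_algebra \<Rightarrow> complex) \<Rightarrow> 'a set \<Rightarrow> 'a set \<Rightarrow> bool" where
  "free_subalgebras \<phi> A B \<longleftrightarrow>
     (\<forall>(n::nat) (a :: nat \<Rightarrow> 'a) (inA :: nat \<Rightarrow> bool).
        n \<ge> 1 \<and>
        (\<forall>i<n. a i \<in> (if inA i then A else B) \<and> \<phi> (a i) = 0) \<and>
        (\<forall>i. Suc i < n \<longrightarrow> inA i \<noteq> inA (Suc i))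
        \<longrightarrow> \<phi> (prod_list (map a [0..<n])) = 0)"

text \<open>The adjoints are included in the generating sets; this is redundant for selfadjoint
  elements.\<close>

definition freely_independent ::
    "('a::cstar_algebra \<Rightarrow> complex) \<Rightarrow> 'a \<Rightarrow> 'a \<Rightarrow> bool" where
  "freely_independent \<phi> a b \<longleftrightarrow>
     free_subalgebras \<phi> (generated_algebra {a, star a}) (generated_algebra {b, star b})"

text \<open>The free Poisson (Marchenko--Pastur) law of rate \<open>p\<close> and jump size \<open>1\<close>, that is, the law all
  of whose free cumulants are equal to \<open>p\<close>.\<close>

definition free_poisson_density :: "real \<Rightarrow> real \<Rightarrow> real" where
  "free_poisson_density p t =
     (if (1 - sqrt p)\<^sup>2 < t \<and> t < (1 + sqrt p)\<^sup>2
      then sqrt ((t - (1 - sqrt p)\<^sup>2) * ((1 + sqrt p)\<^sup>2 - t)) / (2 * pi * t) else 0)"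

definition free_poisson_law :: "real \<Rightarrow> real measure" where
  "free_poisson_law p = measure_of UNIV (sets borel)
     (\<lambda>A. ennreal (max 0 (1 - p)) * indicator A 0
          + (\<integral>\<^sup>+ t \<in> A. ennreal (free_poisson_density p t) \<partial>lborel))"

lemma sets_free_poisson_law [simp]: "sets (free_poisson_law p) = sets borel"
  unfolding free_poisson_law_def by (metis sets.sets_measure_of_eq space_borel)

lemma free_poisson_density_measurable [measurable]:
  "free_poisson_density p \<in> borel_measurable borel"
  unfolding free_poisson_density_def by measurable

lemma emeasure_free_poisson_law:
  assumes "A \<in> sets borel"
  shows "emeasure (free_poisson_law p) A = ennreal (max 0 (1 - p)) * indicator A 0
           + (\<integral>\<^sup>+ t \<in> A. ennreal (free_poisson_density p t) \<partial>lborel)"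
proof -
  let ?M = "scale_measure (ennreal (max 0 (1 - p))) (return borel (0::real))"
  let ?N = "density lborel (\<lambda>t. ennreal (free_poisson_density p t))"
  have eq: "ennreal (max 0 (1 - p)) * indicator B 0
      + (\<integral>\<^sup>+ t \<in> B. ennreal (free_poisson_density p t) \<partial>lborel) = emeasure ?M B + emeasure ?N B"
    if "B \<in> sets borel" for B :: "real set"
    using that by (simp add: emeasure_density)
  show ?thesis
  proof (rule emeasure_measure_of[OF free_poisson_law_def])
    show "countably_additive (sets (free_poisson_law p))
      (\<lambda>A. ennreal (max 0 (1 - p)) * indicator A 0
          + (\<integral>\<^sup>+ t \<in> A. ennreal (free_poisson_density p t) \<partial>lborel))"
    proof (rule countably_additiveI)
      fix B :: "nat \<Rightarrow> real set"
      assume B: "range B \<subseteq> sets (free_poisson_law p)" "disjoint_family B"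
        "\<Union> (range B) \<in> sets (free_poisson_law p)"
      have "(\<Sum>i. emeasure ?M (B i)) = emeasure ?M (\<Union> (range B))"
        and "(\<Sum>i. emeasure ?N (B i)) = emeasure ?N (\<Union> (range B))"
        using B by (intro suminf_emeasure; simp)+
      then have "(\<Sum>i. emeasure ?M (B i) + emeasure ?N (B i))
          = emeasure ?M (\<Union> (range B)) + emeasure ?N (\<Union> (range B))"
        by (simp only: suminf_add[symmetric] summableI)
      moreover have "\<And>i. B i \<in> sets borel" "\<Union> (range B) \<in> sets borel"
        using B by auto
      ultimately show "(\<Sum>i. ennreal (max 0 (1 - p)) * indicator (B i) 0
          + (\<integral>\<^sup>+ t \<in> B i. ennreal (free_poisson_density p t) \<partial>lborel)) =
        ennreal (max 0 (1 - p)) * indicator (\<Union> (range B)) 0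
          + (\<integral>\<^sup>+ t \<in> \<Union> (range B). ennreal (free_poisson_density p t) \<partial>lborel)"
        by (simp only: eq)
    qed
  qed (use assms in \<open>auto simp: positive_def\<close>)
qed

text \<open>The distribution of a selfadjoint element is determined by its moments, as it has bounded
  support.\<close>

definition free_poisson_element ::
    "('a::cstar_algebra \<Rightarrow> complex) \<Rightarrow> real \<Rightarrow> 'a \<Rightarrow> bool" where
  "free_poisson_element \<phi> p y \<longleftrightarrow> selfadjoint y \<and>
     (\<forall>n::nat. integrable (free_poisson_law p) (\<lambda>t. t ^ n) \<and>
        \<phi> (y ^ n) = complex_of_real (\<integral>t. t ^ n \<partial>free_poisson_law p))"


section \<open>The transforms \<open>G\<close> and \<open>H\<close>\<close>

definition adjoint_mat :: "complex^2^2 \<Rightarrow> complex^2^2" where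
  "adjoint_mat B = (\<chi> i j. cnj (B $ j $ i))"

definition Im_mat :: "complex^2^2 \<Rightarrow> complex^2^2" where
  "Im_mat B = (\<chi> i j. (B $ i $ j - adjoint_mat B $ i $ j) / (2 * \<i>))"

definition positive_definite :: "complex^2^2 \<Rightarrow> bool" where
  "positive_definite B \<longleftrightarrow>
     (\<forall>v. v \<noteq> 0 \<longrightarrow> (\<Sum>i\<in>UNIV. cnj (v $ i) * (B *v v) $ i) \<in> \<real>\<^sub>\<ge>\<^sub>0 - {0})"

definition upper_half_plane_mat :: "(complex^2^2) set" where
  "upper_half_plane_mat = {B. positive_definite (Im_mat B) \<and> invertible (Im_mat B)}"

definition Emat :: "('a::cstar_algebra \<Rightarrow> complex) \<Rightarrow> 'a^2^2 \<Rightarrow> complex^2^2" where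
  "Emat \<phi> M = (\<chi> i j. \<phi> (M $ i $ j))"

text \<open>The canonical inclusion of the scalar matrices into the matrices over the algebra.\<close>

definition scalar_mat :: "complex^2^2 \<Rightarrow> 'a::cstar_algebra^2^2" where
  "scalar_mat B = (\<chi> i j. cscale (B $ i $ j) 1)"

definition Xmat :: "'a::cstar_algebra \<Rightarrow> 'a^2^2" where
  "Xmat x = vector [vector [0, x], vector [x, 0]]"

definition Jmat :: "complex^2^2" where
  "Jmat = vector [vector [0, \<i>], vector [- \<i>, 0]]"

text \<open>Only the values of the following two functions on \<open>upper_half_plane_mat\<close> are meaningful.\<close>

definition G :: "('a::cstar_algebra \<Rightarrow> complex) \<Rightarrow> 'a \<Rightarrow> complex^2^2 \<Rightarrow> complex^2^2" where
  "G \<phi> x B = Emat \<phi> (matrix_inv (scalar_mat B - Xmat x))"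

definition H ::
    "('a::cstar_algebra \<Rightarrow> complex) \<Rightarrow> 'a \<Rightarrow> real \<Rightarrow> complex^2^2 \<Rightarrow> complex^2^2" where
  "H \<phi> x p B = B + p *\<^sub>R matrix_inv (Jmat - G \<phi> x B)"

definition Bmat :: "complex \<Rightarrow> complex \<Rightarrow> complex^2^2" where
  "Bmat lam \<zeta> = vector [vector [\<zeta>, lam], vector [cnj lam, \<zeta>]]"

lemma Bmat_in_upper_half_plane_mat:
  assumes "Im \<zeta> > 0"
  shows "Bmat lam \<zeta> \<in> upper_half_plane_mat"
proof -
  have eq: "Im_mat (Bmat lam \<zeta>) = mat (complex_of_real (Im \<zeta>))"
    by (auto simp: Im_mat_def adjoint_mat_def Bmat_def mat_def vec_eq_iff forall_2 vector_2
        complex_eq_iff)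
  have "invertible (mat (complex_of_real (Im \<zeta>)) :: complex^2^2)"
    using assms by (auto simp: invertible_det_nz det_2 mat_def)
  moreover have "positive_definite (mat (complex_of_real (Im \<zeta>)))"
    unfolding positive_definite_def
  proof (intro allI impI)
    fix v :: "complex^2" assume "v \<noteq> 0"
    have "(\<Sum>i\<in>UNIV. cnj (v $ i) * (mat (complex_of_real (Im \<zeta>)) *v v) $ i)
        = complex_of_real (Im \<zeta> * ((cmod (v $ 1))\<^sup>2 + (cmod (v $ 2))\<^sup>2))"
      by (simp add: sum_2 mat_def matrix_vector_mult_def algebra_simps complex_norm_square
          del: of_real_power)
    moreover have "(cmod (v $ 1))\<^sup>2 + (cmod (v $ 2))\<^sup>2 > 0"
      using \<open>v \<noteq> 0\<close> by (auto simp: vec_eq_iff forall_2 sum_power2_gt_zero_iff)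
    ultimately show "(\<Sum>i\<in>UNIV. cnj (v $ i) * (mat (complex_of_real (Im \<zeta>)) *v v) $ i)
        \<in> \<real>\<^sub>\<ge>\<^sub>0 - {0}"
      using assms by (auto simp del: of_real_mult of_real_add)
  qed
  ultimately show ?thesis
    by (simp add: upper_half_plane_mat_def eq)
qed

end

theory Submission
  imports Defs "HOL-Complex_Analysis.Cauchy_Integral_Formula" "HOL-Real_Asymp.Real_Asymp"
begin

text \<open>With \<open>a = \<lambda> - x\<close>, which is normal, the inverse of \<open>B - X\<close> has the entries \<open>\<zeta> R\<close>, \<open>- a R\<close>,
  \<open>- a\<^sup>* R\<close>, \<open>\<zeta> R\<close> where \<open>R = (\<zeta>\<^sup>2 - a a\<^sup>*)\<^sup>-\<^sup>1\<close>; the resolvent \<open>R\<close> exists for \<open>\<zeta>\<close> in the upper half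
  plane because \<open>a a\<^sup>* = (x - Re \<lambda>)\<^sup>2 + (Im \<lambda>)\<^sup>2\<close> and selfadjoint elements have real spectrum. As \<open>\<phi>\<close>
  is a faithful state, \<open>- Im G\<close> is positive definite, hence so is \<open>Im (J - G)\<close>, and the \<open>(1,1)\<close>
  entry \<open>F\<close> of \<open>(J - G)\<^sup>-\<^sup>1\<close> is a holomorphic map to the lower half plane. Since \<open>\<zeta> F \<zeta> \<longrightarrow> 1\<close> at infinity,
  Nevanlinna's theorem makes \<open>F\<close> the Cauchy transform of a probability measure \<open>\<rho>\<close>. At \<open>\<zeta> = i \<delta>\<close>
  the resolvent \<open>R\<close> is selfadjoint, which makes \<open>F\<close> purely imaginary, and
  \<open>Im H\<^sub>1\<^sub>1 / \<delta> = 1 - p \<integral> 1 / (\<delta>\<^sup>2 + t\<^sup>2) d\<rho> t\<close>.\<close>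

section \<open>Resolvents in \<open>C\<^sup>*\<close>-algebras\<close>

lemma cscale_zero_left [simp]: "cscale 0 (a::'a::cstar_algebra) = 0"
  using cscale_of_real[of 0 a] by simp

lemma cscale_one [simp]: "cscale 1 (a::'a::cstar_algebra) = a"
  using cscale_of_real[of 1 a] by simp

lemma cscale_zero_right [simp]: "cscale c (0::'a::cstar_algebra) = 0"
  using norm_cscale[of c "0::'a"] by simp

lemma cscale_minus_left: "cscale (- c) (a::'a::cstar_algebra) = - cscale c a"
  using cscale_add_left[of c "- c" a] by (simp add: eq_neg_iff_add_eq_0 add.commute)

lemma cscale_minus_right: "cscale c (- a::'a::cstar_algebra) = - cscale c a"
  using cscale_add_right[of c a "- a"] by (simp add: eq_neg_iff_add_eq_0 add.commute)

lemma cscale_diff_left: "cscale (c - d) (a::'a::cstar_algebra) = cscale c a - cscale d a"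
  using cscale_add_left[of c "- d" a] by (simp add: cscale_minus_left)

lemma cscale_diff_right: "cscale c (a - b::'a::cstar_algebra) = cscale c a - cscale c b"
  using cscale_add_right[of c a "- b"] by (simp add: cscale_minus_right)

lemma cscale_one_eq_0_iff [simp]: "cscale c (1::'a::cstar_algebra) = 0 \<longleftrightarrow> c = 0"
  using norm_cscale[of c "1::'a"] by auto

lemma star_zero [simp]: "star (0::'a::cstar_algebra) = 0"
  using star_add[of 0 "0::'a"] by simp

lemma star_minus: "star (- a::'a::cstar_algebra) = - star a"
  using star_add[of a "- a"] by (simp add: eq_neg_iff_add_eq_0 add.commute)

lemma star_diff: "star (a - b::'a::cstar_algebra) = star a - star b"
  using star_add[of a "- b"] by (simp add: star_minus)

lemma star_one [simp]: "star (1::'a::cstar_algebra) = 1"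
  by (metis mult.right_neutral star_mult star_star)

lemmas cstar_simps =
  cscale_add_left cscale_add_right cscale_diff_left cscale_diff_right cscale_minus_left
  cscale_minus_right cscale_cscale mult_cscale_left mult_cscale_right
  star_star star_add star_diff star_minus star_mult star_cscale

lemma left_inverse_cancel: "a * b = 1 \<Longrightarrow> a * (b * c) = (c :: 'a::monoid_mult)"
  by (simp flip: mult.assoc)

section \<open>Resolvent set and resolvent\<close>

definition resolvent_set :: "'a::cstar_algebra \<Rightarrow> complex set" where
  "resolvent_set c = {z. \<exists>r. (cscale z 1 - c) * r = 1 \<and> r * (cscale z 1 - c) = 1}"

text \<open>A choice of the two-sided inverse, which is unique on \<open>resolvent_set c\<close>.
  Off that set the value is arbitrary.\<close>

definition resolvent :: "'a::cstar_algebra \<Rightarrow> complex \<Rightarrow> 'a" where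
  "resolvent c z = (SOME r. (cscale z 1 - c) * r = 1 \<and> r * (cscale z 1 - c) = 1)"

lemma resolvent_inverse:
  assumes "z \<in> resolvent_set c"
  shows "(cscale z 1 - c) * resolvent c z = 1" "resolvent c z * (cscale z 1 - c) = 1"
proof -
  have "(cscale z 1 - c) * resolvent c z = 1 \<and> resolvent c z * (cscale z 1 - c) = 1"
    using assms unfolding resolvent_def resolvent_set_def mem_Collect_eq by (rule someI_ex)
  then show "(cscale z 1 - c) * resolvent c z = 1" "resolvent c z * (cscale z 1 - c) = 1"
    by auto
qed

lemma resolvent_unique:
  assumes "(cscale z 1 - c) * r = 1" "r * (cscale z 1 - c) = 1"
  shows "resolvent c z = r"
proof -
  have "z \<in> resolvent_set c"
    using assms by (auto simp: resolvent_set_def)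
  from resolvent_inverse(2)[OF this] have "resolvent c z * (cscale z 1 - c) * r = r"
    by simp
  then show ?thesis using assms(1) by (simp add: mult.assoc)
qed

text \<open>Neumann series: for \<open>q = a / z\<close>, of norm below 1, the geometric sum
  \<open>s\<close> inverts \<open>1 - q\<close>, so \<open>s / z\<close> inverts
  \<open>z - a\<close>.\<close>

lemma norm_less_imp_resolvent_set:
  fixes a :: "'a::cstar_algebra"
  assumes "norm a < cmod z"
  shows "z \<in> resolvent_set a"
proof -
  have z: "z \<noteq> 0" using assms by auto
  define q where "q = cscale (1 / z) a"
  have "norm q = norm a / cmod z"
    by (simp add: q_def norm_cscale norm_divide)
  then have "norm q < 1"
    using assms z by simp
  then have sum: "summable (\<lambda>n. q ^ n)"
    by (rule complete_algebra_summable_geometric)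
  define s where "s = (\<Sum>n. q ^ n)"
  have "s = 1 + (\<Sum>n. q ^ Suc n)"
    unfolding s_def using suminf_split_head[OF sum] by simp
  moreover have "(\<Sum>n. q ^ Suc n) = q * s" "(\<Sum>n. q ^ Suc n) = s * q"
    unfolding s_def using suminf_mult[OF sum, of q] suminf_mult2[OF sum, of q]
    by (simp_all add: power_commutes)
  ultimately have s: "(1 - q) * s = 1" "s * (1 - q) = 1"
    by (simp_all add: algebra_simps)
  have "cscale z 1 - a = cscale z (1 - q)"
    using z by (simp add: q_def cstar_simps)
  then have "(cscale z 1 - a) * cscale (1 / z) s = 1" "cscale (1 / z) s * (cscale z 1 - a) = 1"
    using s z by (simp_all add: mult_cscale_left mult_cscale_right cscale_cscale)
  then show ?thesis by (auto simp: resolvent_set_def)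
qed

text \<open>Arens' argument: translating by a large imaginary number \<open>t\<close> moves \<open>w\<close> outside the disc
  of radius \<open>norm (b + \<i> t)\<close>, because \<open>(norm (b + \<i> t))\<^sup>2\<close> grows only by \<open>t\<^sup>2\<close>.\<close>

lemma selfadjoint_resolvent_set:
  fixes b :: "'a::cstar_algebra"
  assumes "selfadjoint b" "Im w \<noteq> 0"
  shows "w \<in> resolvent_set b"
proof -
  have sb: "star b = b" using assms by (simp add: selfadjoint_def)
  \<comment> \<open>The cross term \<open>2 * (Im w * t)\<close> of the squared modulus of
    \<open>w + \<i> t\<close> becomes twice \<open>(norm b)\<^sup>2\<close>, which beats the single
    \<open>(norm b)\<^sup>2\<close> in the bound for \<open>d\<close>.\<close>
  define t where "t = (norm b)\<^sup>2 / Im w"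
  define d where "d = b + cscale (\<i> * of_real t) 1"
  have "star d * d = b * b + t\<^sup>2 *\<^sub>R 1"
    by (simp add: d_def sb cstar_simps algebra_simps power2_eq_square flip: cscale_of_real)
  then have "(norm d)\<^sup>2 = norm (b * b + t\<^sup>2 *\<^sub>R 1)"
    by (metis cstar_identity)
  also have "\<dots> \<le> (norm b)\<^sup>2 + t\<^sup>2"
    by (rule norm_triangle_le) (simp add: norm_mult_ineq power2_eq_square)
  also have "\<dots> < (cmod (w + \<i> * of_real t))\<^sup>2"
  proof -
    have "(cmod (w + \<i> * of_real t))\<^sup>2 = (Re w)\<^sup>2 + (Im w)\<^sup>2 + 2 * (Im w * t) + t\<^sup>2"
      unfolding cmod_power2 by (simp add: power2_eq_square algebra_simps)
    moreover have "Im w * t = (norm b)\<^sup>2" "0 < (Im w)\<^sup>2"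
      using assms by (auto simp: t_def)
    ultimately show ?thesis
      using zero_le_power2[of "Re w"] zero_le_power2[of "norm b"] by linarith
  qed
  finally have "norm d < cmod (w + \<i> * of_real t)"
    by (simp add: power2_less_imp_less)
  then have "w + \<i> * of_real t \<in> resolvent_set d"
    by (rule norm_less_imp_resolvent_set)
  moreover have "cscale (w + \<i> * of_real t) 1 - d = cscale w 1 - b"
    by (simp add: d_def cstar_simps)
  ultimately show ?thesis by (simp add: resolvent_set_def)
qed

text \<open>For a square root \<open>w\<close> of \<open>z - d\<^sup>2\<close>, the element
  \<open>z - (b\<^sup>2 + d\<^sup>2)\<close> factors as \<open>- (w - b) (- w - b)\<close>. A real
  \<open>w\<close> would make \<open>z = w\<^sup>2 + d\<^sup>2\<close> a nonnegative real; hence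
  \<open>w\<close> and \<open>- w\<close> both lie in the resolvent set of \<open>b\<close>.\<close>

lemma selfadjoint_square_resolvent_set:
  fixes b :: "'a::cstar_algebra"
  assumes "selfadjoint b" "z \<notin> \<real>\<^sub>\<ge>\<^sub>0"
  shows "z \<in> resolvent_set (b * b + cscale (of_real (d\<^sup>2)) 1)"
proof -
  define w where "w = csqrt (z - of_real (d\<^sup>2))"
  have w2: "z = w * w + of_real (d\<^sup>2)"
    using power2_csqrt[of "z - of_real (d\<^sup>2)"] by (simp add: w_def power2_eq_square)
  have "Im w \<noteq> 0"
  proof
    assume "Im w = 0"
    then have "z = of_real ((Re w)\<^sup>2 + d\<^sup>2)"
      unfolding w2 by (simp add: complex_eq_iff power2_eq_square)
    then show False using assms(2) by (simp only: nonneg_Reals_of_real_iff) simp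
  qed
  then have "w \<in> resolvent_set b" "- w \<in> resolvent_set b"
    using assms by (auto intro: selfadjoint_resolvent_set)
  then obtain r s where r: "(cscale w 1 - b) * r = 1" "r * (cscale w 1 - b) = 1"
    and s: "(cscale (- w) 1 - b) * s = 1" "s * (cscale (- w) 1 - b) = 1"
    by (auto simp: resolvent_set_def)
  have fact: "cscale z 1 - (b * b + cscale (of_real (d\<^sup>2)) 1)
      = - ((cscale w 1 - b) * (cscale (- w) 1 - b))"
    by (simp add: w2 cstar_simps algebra_simps del: of_real_power)
  have "(cscale z 1 - (b * b + cscale (of_real (d\<^sup>2)) 1)) * (- (s * r)) = 1"
    unfolding fact using r(1) by (simp add: mult.assoc left_inverse_cancel[OF s(1)])
  moreover have "(- (s * r)) * (cscale z 1 - (b * b + cscale (of_real (d\<^sup>2)) 1)) = 1"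
    unfolding fact using s(2) by (simp add: mult.assoc left_inverse_cancel[OF r(2)])
  ultimately show ?thesis unfolding resolvent_set_def by blast
qed

lemma resolvent_commute:
  assumes "z \<in> resolvent_set c" "a * c = c * a"
  shows "a * resolvent c z = resolvent c z * a"
proof -
  let ?R = "resolvent c z"
  have "a * (cscale z 1 - c) = (cscale z 1 - c) * a"
    using assms(2) by (simp add: cstar_simps algebra_simps)
  then have "?R * (a * (cscale z 1 - c)) * ?R = ?R * ((cscale z 1 - c) * a) * ?R"
    by simp
  then show ?thesis
    using resolvent_inverse(1)[OF assms(1)] left_inverse_cancel[OF resolvent_inverse(2)[OF assms(1)]]
    by (simp add: mult.assoc)
qed

lemma star_resolvent:
  assumes "z \<in> resolvent_set c"
  shows "star (resolvent c z) = resolvent (star c) (cnj z)"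
proof (rule resolvent_unique[symmetric])
  have "star (cscale z 1 - c) = cscale (cnj z) 1 - star c"
    by (simp add: cstar_simps)
  then show "(cscale (cnj z) 1 - star c) * star (resolvent c z) = 1"
    "star (resolvent c z) * (cscale (cnj z) 1 - star c) = 1"
    using resolvent_inverse[OF assms] by (metis star_mult star_one)+
qed

lemma resolvent_identity:
  assumes "z \<in> resolvent_set c" "w \<in> resolvent_set c"
  shows "resolvent c w - resolvent c z = cscale (z - w) (resolvent c w * resolvent c z)"
proof -
  define Z W where "Z = cscale z 1 - c" and "W = cscale w 1 - c"
  have "resolvent c w * Z * resolvent c z = resolvent c w"
    unfolding Z_def using resolvent_inverse(1)[OF assms(1)] by (simp add: mult.assoc)
  moreover have "resolvent c w * W * resolvent c z = resolvent c z"
    unfolding W_def using resolvent_inverse(2)[OF assms(2)] by simp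
  ultimately have "resolvent c w - resolvent c z = resolvent c w * (Z - W) * resolvent c z"
    by (simp add: right_diff_distrib left_diff_distrib)
  also have "Z - W = cscale (z - w) 1"
    by (simp add: Z_def W_def cscale_diff_left)
  finally show ?thesis by (simp add: mult_cscale_left mult_cscale_right)
qed

text \<open>The resolvent identity bounds the increment by \<open>dist w z\<close> times
  \<open>norm (resolvent c w) * n\<close>. The same inequality first bounds
  \<open>norm (resolvent c w)\<close> by \<open>2 * n\<close> near \<open>z\<close>, after which the
  increment is \<open>O(dist w z)\<close>.\<close>

lemma tendsto_resolvent:
  assumes z: "z \<in> resolvent_set c" and S: "S \<subseteq> resolvent_set c"
  shows "(resolvent c \<longlongrightarrow> resolvent c z) (at z within S)"
proof (rule LIM_zero_cancel, rule Lim_null_comparison)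
  define n where "n = norm (resolvent c z)"
  have bound: "norm (resolvent c w - resolvent c z) \<le> dist w z * (norm (resolvent c w) * n)"
    if "w \<in> S" for w
  proof -
    have "w \<in> resolvent_set c" using that S by auto
    from resolvent_identity[OF z this] show ?thesis
      by (simp add: norm_cscale n_def dist_norm norm_minus_commute mult_left_mono norm_mult_ineq)
  qed
  \<comment> \<open>This radius forces \<open>dist w z * n \<le> 1 / 2\<close>, so half of
    \<open>norm (resolvent c w)\<close> can be absorbed on the left. The \<open>+ 1\<close> makes it
    positive from \<open>0 \<le> n\<close> alone.\<close>
  have "eventually (\<lambda>w. w \<in> S \<and> dist w z < 1 / (2 * n + 1)) (at z within S)"
  proof -
    have "0 < 1 / (2 * n + 1)"
      using norm_ge_zero[of "resolvent c z"] unfolding n_def by (simp add: add_nonneg_pos)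
    then show ?thesis unfolding eventually_at by blast
  qed
  then show "\<forall>\<^sub>F w in at z within S. norm (resolvent c w - resolvent c z) \<le> dist w z * (2 * n * n)"
  proof eventually_elim
    case (elim w)
    have n: "0 \<le> n" by (simp add: n_def)
    have "norm (resolvent c w) \<le> n + dist w z * n * norm (resolvent c w)"
      using bound[of w] norm_triangle_sub[of "resolvent c w" "resolvent c z"] elim
      unfolding n_def by (simp add: algebra_simps)
    moreover have "dist w z * n \<le> 1 / 2"
    proof -
      have "dist w z * (2 * n + 1) < 1"
        using elim n by (simp add: field_simps)
      moreover have "dist w z * (2 * n + 1) = 2 * (dist w z * n) + dist w z"
        by (simp add: algebra_simps)
      ultimately show ?thesis using zero_le_dist[of w z] by linarith
    qed
    then have "dist w z * n * norm (resolvent c w) \<le> 1 / 2 * norm (resolvent c w)"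
      by (rule mult_right_mono) simp
    ultimately have "norm (resolvent c w) \<le> 2 * n" by simp
    then have "dist w z * (norm (resolvent c w) * n) \<le> dist w z * (2 * n * n)"
      using n by (intro mult_left_mono mult_right_mono) auto
    with bound[of w] elim show ?case by simp
  qed
  have "((\<lambda>w. dist w z * (2 * n * n)) \<longlongrightarrow> dist z z * (2 * n * n)) (at z within S)"
    by (intro tendsto_intros)
  then show "((\<lambda>w. dist w z * (2 * n * n)) \<longlongrightarrow> 0) (at z within S)" by simp
qed

text \<open>By the resolvent identity the difference quotient is
  \<open>- \<phi> (e R(w) R(z))\<close>, which converges by continuity of the resolvent. The factor
  \<open>e\<close> allows for all entries of \<open>G\<close>, where it is \<open>1\<close>,
  \<open>a\<close> or \<open>star a\<close>.\<close>

lemma holomorphic_on_functional_resolvent: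
  fixes \<phi> :: "'a::cstar_algebra \<Rightarrow> complex"
  assumes \<phi>: "bounded_clinear_functional \<phi>" and S: "S \<subseteq> resolvent_set c"
  shows "(\<lambda>z. \<phi> (e * resolvent c z)) holomorphic_on S"
proof -
  interpret bounded_linear \<phi>
    using \<phi> by (simp add: bounded_clinear_functional_def)
  have scale: "\<phi> (cscale k a) = k * \<phi> a" for k a
    using \<phi> by (simp add: bounded_clinear_functional_def clinear_functional_def)
  have "((\<lambda>z. \<phi> (e * resolvent c z)) has_field_derivative
      \<phi> (- (e * (resolvent c z * resolvent c z)))) (at z within S)" if "z \<in> S" for z
  proof -
    have z: "z \<in> resolvent_set c" using that S by auto
    have "((\<lambda>w. \<phi> (- (e * (resolvent c w * resolvent c z)))) \<longlongrightarrow>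
        \<phi> (- (e * (resolvent c z * resolvent c z)))) (at z within S)"
      by (intro tendsto tendsto_intros tendsto_resolvent[OF z S])
    moreover have "eventually (\<lambda>w. \<phi> (- (e * (resolvent c w * resolvent c z)))
        = (\<phi> (e * resolvent c w) - \<phi> (e * resolvent c z)) / (w - z)) (at z within S)"
      unfolding eventually_at_filter
    proof (intro always_eventually allI impI)
      fix w assume w: "w \<noteq> z" "w \<in> S"
      have "\<phi> (e * resolvent c w) - \<phi> (e * resolvent c z) = \<phi> (e * (resolvent c w - resolvent c z))"
        by (simp add: diff right_diff_distrib)
      also have "\<dots> = (z - w) * \<phi> (e * (resolvent c w * resolvent c z))"
        using w S by (subst resolvent_identity[OF z]) (auto simp: mult_cscale_right scale)
      finally show "\<phi> (- (e * (resolvent c w * resolvent c z)))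
        = (\<phi> (e * resolvent c w) - \<phi> (e * resolvent c z)) / (w - z)"
        using w by (simp add: neg field_simps)
    qed
    ultimately show ?thesis
      unfolding has_field_derivative_iff by (rule Lim_transform_eventually)
  qed
  then show ?thesis
    unfolding holomorphic_on_def field_differentiable_def by blast
qed

text \<open>From \<open>(z - c) R = 1\<close> one has \<open>z R = 1 + c R\<close>. For
  \<open>cmod z\<close> at least \<open>2 * norm c\<close> the last term is absorbed, so
  \<open>norm R\<close> is at most \<open>2 / cmod z\<close>; then \<open>z R - 1 = c R\<close>
  tends to 0 as well.\<close>

lemma resolvent_at_infinity:
  fixes c :: "'a::cstar_algebra"
  shows "(resolvent c \<longlongrightarrow> 0) at_infinity"
    and "((\<lambda>z. cscale z (resolvent c z)) \<longlongrightarrow> 1) at_infinity"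
proof -
  have lin: "cscale z (resolvent c z) - 1 = c * resolvent c z" if "norm c < cmod z" for z
    using resolvent_inverse(1)[OF norm_less_imp_resolvent_set[OF that]]
    by (simp add: cstar_simps algebra_simps)
  show lim0: "(resolvent c \<longlongrightarrow> 0) at_infinity"
  proof (rule Lim_null_comparison)
    show "\<forall>\<^sub>F z in at_infinity. norm (resolvent c z) \<le> 2 * inverse (cmod z)"
      unfolding eventually_at_infinity
    proof (intro exI allI impI)
      fix z assume "2 * norm c + 1 \<le> cmod z"
      then have z: "norm c < cmod z" "2 * norm c \<le> cmod z" "0 < cmod z"
        using norm_ge_zero[of c] by linarith+
      have "cmod z * norm (resolvent c z) = norm (1 + c * resolvent c z)"
        using lin[OF z(1)] by (simp add: diff_eq_eq add.commute flip: norm_cscale)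
      also have "\<dots> \<le> 1 + norm c * norm (resolvent c z)"
        by (rule norm_triangle_le) (simp add: norm_mult_ineq)
      also have "norm c * norm (resolvent c z) \<le> cmod z / 2 * norm (resolvent c z)"
        using z by (intro mult_right_mono) auto
      finally show "norm (resolvent c z) \<le> 2 * inverse (cmod z)"
        using z by (simp add: field_simps)
    qed
    have "((\<lambda>z::complex. 2 * inverse (cmod z)) \<longlongrightarrow> 2 * 0) at_infinity"
      by (rule tendsto_mult[OF tendsto_const tendsto_inverse_0_at_top[OF filterlim_norm_at_top]])
    then show "((\<lambda>z::complex. 2 * inverse (cmod z)) \<longlongrightarrow> 0) at_infinity" by simp
  qed
  have "((\<lambda>z. c * resolvent c z) \<longlongrightarrow> c * 0) at_infinity"
    by (intro tendsto_intros lim0)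
  moreover have "\<forall>\<^sub>F z in at_infinity. c * resolvent c z = cscale z (resolvent c z) - 1"
    unfolding eventually_at_infinity
    by (rule exI[of _ "norm c + 1"]) (auto simp: lin)
  ultimately have "((\<lambda>z. cscale z (resolvent c z) - 1) \<longlongrightarrow> 0) at_infinity"
    by (simp add: Lim_transform_eventually)
  then show "((\<lambda>z. cscale z (resolvent c z)) \<longlongrightarrow> 1) at_infinity"
    by (rule LIM_zero_cancel)
qed

text \<open>Polarisation: \<open>\<phi>\<close> is real on \<open>star u * u\<close>. Taking
  \<open>u = 1 + a\<close> compares the imaginary parts of \<open>\<phi> a\<close> and
  \<open>\<phi> (star a)\<close>, and \<open>u = 1 + \<i> a\<close> compares the real parts.\<close>

lemma state_star:
  fixes \<phi> :: "'a::cstar_algebra \<Rightarrow> complex"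
  assumes "state \<phi>"
  shows "\<phi> (star a) = cnj (\<phi> a)"
proof -
  have add: "\<phi> (u + v) = \<phi> u + \<phi> v" and scale: "\<phi> (cscale k u) = k * \<phi> u" and one: "\<phi> 1 = 1"
    and pos: "\<phi> (star u * u) \<in> \<real>\<^sub>\<ge>\<^sub>0" for u v k
    using assms by (auto simp: state_def clinear_functional_def)
  have im: "Im (\<phi> (star u * u)) = 0" for u
    using pos[of u] by (simp add: complex_nonneg_Reals_iff)
  have "star (1 + a) * (1 + a) = 1 + (a + (star a + star a * a))"
    by (simp add: cstar_simps algebra_simps)
  then have 1: "Im (\<phi> a) + Im (\<phi> (star a)) = 0"
    using im[of "1 + a"] im[of a] by (simp add: add one)
  have "star (1 + cscale \<i> a) * (1 + cscale \<i> a)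
      = 1 + (cscale \<i> a + (cscale (- \<i>) (star a) + star a * a))"
    by (simp add: cstar_simps algebra_simps)
  then have "Re (\<phi> a) - Re (\<phi> (star a)) = 0"
    using im[of "1 + cscale \<i> a"] im[of a] by (simp add: add one scale)
  with 1 show ?thesis by (simp add: complex_eq_iff)
qed

section \<open>Nevanlinna's theorem on Cauchy transforms\<close>

text \<open>Domination by a multiple of \<open>1 / (1 + t\<^sup>2)\<close>: compactness handles
  \<open>{-s..s}\<close>, and outside it \<open>\<bar>t\<bar> \<ge> 1\<close> gives
  \<open>1 / t\<^sup>2 \<le> 2 / (1 + t\<^sup>2)\<close>.\<close>

lemma integrable_real_of_quadratic_decay:
  fixes g :: "real \<Rightarrow> 'b::{banach, second_countable_topology}"
  assumes cont: "continuous_on UNIV g"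
    and bound: "\<And>t. r \<le> \<bar>t\<bar> \<Longrightarrow> norm (g t) \<le> C / t\<^sup>2"
  shows "integrable lborel g"
proof -
  define s where "s = max r 1"
  have "compact ((\<lambda>t. (1 + t\<^sup>2) *\<^sub>R g t) ` {-s..s})"
    by (intro compact_continuous_image continuous_intros continuous_on_subset[OF cont]) auto
  then obtain B where "\<forall>y \<in> (\<lambda>t. (1 + t\<^sup>2) *\<^sub>R g t) ` {-s..s}. norm y \<le> B"
    using compact_imp_bounded bounded_iff by metis
  then have B: "norm ((1 + t\<^sup>2) *\<^sub>R g t) \<le> B" if "t \<in> {-s..s}" for t
    using that by blast
  have le: "norm (g t) \<le> max B (2 * \<bar>C\<bar>) * inverse (1 + t\<^sup>2)" for t
  proof (cases "t \<in> {-s..s}")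
    case True
    have "0 < 1 + t\<^sup>2" by (smt (verit) zero_le_power2)
    with B[OF True] have "norm (g t) \<le> B / (1 + t\<^sup>2)"
      by (simp add: pos_le_divide_eq mult.commute del: scaleR_add_left)
    also have "\<dots> \<le> max B (2 * \<bar>C\<bar>) / (1 + t\<^sup>2)"
      using \<open>0 < 1 + t\<^sup>2\<close> by (intro divide_right_mono) auto
    finally show ?thesis by (simp add: divide_inverse)
  next
    case False
    then have t: "r \<le> \<bar>t\<bar>" "1 \<le> \<bar>t\<bar>" by (auto simp: s_def)
    then have "1 \<le> t\<^sup>2" by (metis abs_le_square_iff abs_one one_power2)
    have "norm (g t) \<le> \<bar>C\<bar> / t\<^sup>2"
      using bound[OF t(1)] by (smt (verit) divide_right_mono zero_le_power2)
    also have "\<dots> = (2 * \<bar>C\<bar>) / (2 * t\<^sup>2)"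
      by simp
    also have "\<dots> \<le> (2 * \<bar>C\<bar>) / (1 + t\<^sup>2)"
      using \<open>1 \<le> t\<^sup>2\<close> by (intro divide_left_mono mult_pos_pos) auto
    also have "\<dots> \<le> max B (2 * \<bar>C\<bar>) / (1 + t\<^sup>2)"
      by (intro divide_right_mono) auto
    finally show ?thesis by (simp add: divide_inverse)
  qed
  have "integrable lborel (\<lambda>t::real. inverse (1 + t\<^sup>2))"
    using integrable_inverse_1_plus_square by (simp add: set_integrable_def)
  then have "integrable lborel (\<lambda>t. max B (2 * \<bar>C\<bar>) * inverse (1 + t\<^sup>2))"
    by simp
  then show ?thesis
  proof (rule Bochner_Integration.integrable_bound)
    show "g \<in> borel_measurable lborel"
      using borel_measurable_continuous_onI[OF cont] by simp
    show "AE t in lborel. norm (g t) \<le> norm (max B (2 * \<bar>C\<bar>) * inverse (1 + t\<^sup>2))"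
      using le by (intro AE_I2) (smt (verit) real_norm_def)
  qed
qed

text \<open>Contour integrals along real segments come out as gauge integrals; dominated convergence
  links their limit to the Lebesgue integral over the line.\<close>

lemma lebesgue_integral_interval_tendsto:
  fixes g :: "real \<Rightarrow> 'b::euclidean_space"
  assumes "integrable lborel g"
  shows "((\<lambda>r. integral {-r..r} g) \<longlongrightarrow> (\<integral>t. g t \<partial>lborel)) at_top"
proof (rule tendsto_at_topI_sequentially)
  fix X :: "nat \<Rightarrow> real" assume X: "filterlim X at_top sequentially"
  have si: "set_integrable lborel {-r..r} g" for r :: real
    using assms by (simp add: set_integrable_def integrable_mult_indicator)
  have "(\<lambda>n. \<integral>t. indicator {-X n..X n} t *\<^sub>R g t \<partial>lborel) \<longlonglongrightarrow> (\<integral>t. g t \<partial>lborel)"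
  proof (rule integral_dominated_convergence)
    show "integrable lborel (\<lambda>t. norm (g t))" using assms by simp
    show "AE t in lborel. (\<lambda>n. indicator {-X n..X n} t *\<^sub>R g t) \<longlonglongrightarrow> g t"
    proof (intro AE_I2 tendsto_eventually)
      fix t :: real
      have "eventually (\<lambda>n. \<bar>t\<bar> \<le> X n) sequentially"
        using X by (simp add: filterlim_at_top)
      then show "eventually (\<lambda>n. indicator {-X n..X n} t *\<^sub>R g t = g t) sequentially"
        by eventually_elim (auto simp: indicator_def)
    qed
  qed (use assms in \<open>auto simp: indicator_def\<close>)
  then show "(\<lambda>n. integral {-X n..X n} g) \<longlonglongrightarrow> (\<integral>t. g t \<partial>lborel)"
    using set_borel_integral_eq_integral(2)[OF si] by (simp add: set_lebesgue_integral_def)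
qed

text \<open>The rectangle has base \<open>{-R..R}\<close> and height \<open>R\<close>. Its other
  three sides have total length \<open>4 * R\<close> and carry an integrand of size
  \<open>O(1 / R\<^sup>2)\<close>, so they contribute \<open>O(1 / R)\<close> and only the base
  survives in the limit.\<close>

lemma contour_integral_rectpath_real_limit:
  fixes h :: "complex \<Rightarrow> complex"
  assumes cont: "continuous_on UNIV (\<lambda>t::real. h (of_real t))"
    and bound: "\<And>z. 0 \<le> Im z \<Longrightarrow> r \<le> cmod z \<Longrightarrow> cmod (h z) \<le> C / (cmod z)\<^sup>2"
    and int: "\<And>R. r \<le> R \<Longrightarrow> (h has_contour_integral I) (rectpath (of_real (-R)) (Complex R R))"
  shows "integrable lborel (\<lambda>t. h (of_real t))" "(\<integral>t. h (of_real t) \<partial>lborel) = I"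
proof -
  show int_h: "integrable lborel (\<lambda>t. h (of_real t))"
    using bound[of "of_real _"]
    by (intro integrable_real_of_quadratic_decay[OF cont, of r C]) auto
  have near: "cmod (integral {-R..R} (\<lambda>t. h (of_real t)) - I) \<le> 4 * \<bar>C\<bar> / R"
    if R: "r \<le> R" "0 < R" for R
  proof -
    let ?a = "of_real (-R) :: complex" and ?b = "of_real R :: complex"
    let ?c = "Complex R R" and ?d = "Complex (-R) R"
    have rp: "rectpath ?a ?c = linepath ?a ?b +++ linepath ?b ?c +++ linepath ?c ?d +++ linepath ?d ?a"
      by (simp add: rectpath_def Let_def complex_of_real_def)
    have ci: "h contour_integrable_on (rectpath ?a ?c)"
      using int[OF R(1)] by (auto simp: contour_integrable_on_def)
    note ci' = ci[unfolded rp]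
    have i1: "h contour_integrable_on linepath ?a ?b"
      and i2: "h contour_integrable_on linepath ?b ?c"
      and i3: "h contour_integrable_on linepath ?c ?d"
      and i4: "h contour_integrable_on linepath ?d ?a"
      using ci' by (auto simp: contour_integrable_join)
    have "I = contour_integral (rectpath ?a ?c) h"
      using int[OF R(1)] by (simp add: contour_integral_unique)
    also have "\<dots> = contour_integral (linepath ?a ?b) h + (contour_integral (linepath ?b ?c) h
        + (contour_integral (linepath ?c ?d) h + contour_integral (linepath ?d ?a) h))"
      unfolding rp using i1 i2 i3 i4 by (simp add: contour_integrable_join)
    also have "contour_integral (linepath ?a ?b) h = integral {-R..R} (\<lambda>t. h (of_real t))"
      using R by (subst contour_integral_linepath_Reals_eq) auto
    finally have eq: "integral {-R..R} (\<lambda>t. h (of_real t)) - I = - (contour_integral (linepath ?b ?c) h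
        + (contour_integral (linepath ?c ?d) h + contour_integral (linepath ?d ?a) h))"
      by (simp add: algebra_simps)
    have far: "cmod (h z) \<le> \<bar>C\<bar> / R\<^sup>2" if "0 \<le> Im z" "R \<le> cmod z" for z
    proof -
      have "cmod (h z) \<le> \<bar>C\<bar> / (cmod z)\<^sup>2"
        using bound[of z] that R by (smt (verit) divide_right_mono zero_le_power2)
      also have "\<dots> \<le> \<bar>C\<bar> / R\<^sup>2"
        using that R by (intro divide_left_mono power_mono mult_pos_pos zero_less_power) auto
      finally show ?thesis .
    qed
    have seg: "0 \<le> Im z \<and> R \<le> cmod z"
      if "z \<in> closed_segment ?b ?c \<union> closed_segment ?c ?d \<union> closed_segment ?d ?a" for z
    proof -
      have "(Re z = R \<or> Re z = -R \<or> Im z = R) \<and> 0 \<le> Im z"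
        using that R by (auto simp: closed_segment_same_Re closed_segment_same_Im closed_segment_eq_real_ivl)
      then show ?thesis
        using abs_Re_le_cmod[of z] abs_Im_le_cmod[of z] by auto
    qed
    have C0: "0 \<le> \<bar>C\<bar> / R\<^sup>2" by simp
    have n2: "cmod (contour_integral (linepath ?b ?c) h) \<le> \<bar>C\<bar> / R\<^sup>2 * cmod (?c - ?b)"
      using seg far by (intro contour_integral_bound_linepath i2 C0) auto
    have n3: "cmod (contour_integral (linepath ?c ?d) h) \<le> \<bar>C\<bar> / R\<^sup>2 * cmod (?d - ?c)"
      using seg far by (intro contour_integral_bound_linepath i3 C0) auto
    have n4: "cmod (contour_integral (linepath ?d ?a) h) \<le> \<bar>C\<bar> / R\<^sup>2 * cmod (?a - ?d)"
      using seg far by (intro contour_integral_bound_linepath i4 C0) auto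
    have "cmod (?c - ?b) = R" "cmod (?d - ?c) = 2 * R" "cmod (?a - ?d) = R"
      using R cmod_eq_Im[of "?c - ?b"] cmod_eq_Re[of "?d - ?c"] cmod_eq_Im[of "?a - ?d"] by auto
    with n2 n3 n4 have "cmod (contour_integral (linepath ?b ?c) h
        + (contour_integral (linepath ?c ?d) h + contour_integral (linepath ?d ?a) h))
      \<le> \<bar>C\<bar> / R\<^sup>2 * R + (\<bar>C\<bar> / R\<^sup>2 * (2 * R) + \<bar>C\<bar> / R\<^sup>2 * R)"
      by (smt (verit) norm_triangle_ineq)
    also have "\<dots> = 4 * \<bar>C\<bar> / R"
      using R by (simp add: field_simps power2_eq_square)
    finally show ?thesis by (simp only: eq norm_minus_cancel)
  qed
  have "((\<lambda>R. integral {-R..R} (\<lambda>t. h (of_real t)) - I) \<longlongrightarrow> 0) at_top"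
  proof (rule Lim_null_comparison)
    show "eventually (\<lambda>R. cmod (integral {-R..R} (\<lambda>t. h (of_real t)) - I) \<le> 4 * \<bar>C\<bar> / R) at_top"
      using eventually_ge_at_top[of r] eventually_gt_at_top[of 0] by eventually_elim (rule near)
    show "((\<lambda>R. 4 * \<bar>C\<bar> / R) \<longlongrightarrow> 0) at_top"
      by (intro tendsto_divide_0[OF tendsto_const]) (simp add: filterlim_at_top_imp_at_infinity filterlim_ident)
  qed
  then have "((\<lambda>R. integral {-R..R} (\<lambda>t. h (of_real t))) \<longlongrightarrow> I) at_top"
    by (simp add: LIM_zero_iff)
  with lebesgue_integral_interval_tendsto[OF int_h]
  show "(\<integral>t. h (of_real t) \<partial>lborel) = I"
    by (rule tendsto_unique[OF trivial_limit_at_top_linorder])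
qed

text \<open>Subtracting the conjugate of the vanishing Cauchy integral at the reflected point
  \<open>cnj z\<close> from the one at \<open>z\<close> leaves only the imaginary part of the boundary values.\<close>

lemma half_plane_Cauchy_Im:
  fixes f :: "complex \<Rightarrow> complex"
  assumes "0 < e" and hol: "f holomorphic_on {z. -e < Im z}"
    and bound: "\<And>z. 0 \<le> Im z \<Longrightarrow> r \<le> cmod z \<Longrightarrow> cmod (f z) \<le> C / cmod z"
    and z: "0 < Im z"
  shows "integrable lborel (\<lambda>t. of_real (Im (f (of_real t))) / (z - of_real t))"
    and "f z = (\<integral>t. of_real (- Im (f (of_real t)) / pi) / (z - of_real t) \<partial>lborel)"
proof -
  \<comment> \<open>Beyond \<open>R0\<close> the decay of \<open>f\<close> applies and
    \<open>cmod (u - w) \<ge> cmod u / 2\<close> whenever \<open>cmod w = cmod z\<close>. This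
    serves \<open>w = z\<close> and \<open>w = cnj z\<close> alike, and \<open>z\<close> lies
    strictly inside each rectangle of size \<open>R \<ge> R0\<close>.\<close>
  define R0 where "R0 = max (max r 1) (2 * cmod z)"
  have cf: "continuous_on UNIV (\<lambda>t::real. f (of_real t))"
    using \<open>0 < e\<close>
    by (intro continuous_on_compose2[OF holomorphic_on_imp_continuous_on[OF hol]]
        continuous_intros) auto
  have ne: "of_real t - w \<noteq> 0" if "Im w \<noteq> 0" for t :: real and w
    using that by (auto simp: complex_eq_iff)
  have cont: "continuous_on UNIV (\<lambda>t::real. f (of_real t) / (of_real t - w))" if "Im w \<noteq> 0" for w
    by (intro continuous_intros cf) (use ne[OF that] in auto)
  have bd: "cmod (f u / (u - w)) \<le> (2 * \<bar>C\<bar>) / (cmod u)\<^sup>2"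
    if "0 \<le> Im u" "R0 \<le> cmod u" "cmod w = cmod z" for u w
  proof -
    have u: "1 \<le> cmod u" "r \<le> cmod u" "2 * cmod w \<le> cmod u"
      using that by (auto simp: R0_def)
    have "cmod u / 2 \<le> cmod (u - w)"
      using norm_triangle_ineq2[of u w] u by simp
    moreover have "cmod (f u) \<le> \<bar>C\<bar> / cmod u"
      using bound[of u] that u by (smt (verit) divide_right_mono norm_ge_zero)
    ultimately have "cmod (f u) / cmod (u - w) \<le> (\<bar>C\<bar> / cmod u) / (cmod u / 2)"
      using u by (intro frac_le) auto
    then show ?thesis
      by (simp add: norm_divide power2_eq_square mult.commute)
  qed
  have rect: "path_image (rectpath (of_real (-R)) (Complex R R)) \<subseteq> {w. 0 \<le> Im w} - {z}"
    if "R0 \<le> R" for R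
  proof -
    have R: "0 < R" "cmod z < R" using that z by (auto simp: R0_def)
    have "\<bar>Re z\<bar> < R" "Im z < R"
      using abs_Re_le_cmod[of z] abs_Im_le_cmod[of z] R by auto
    then show ?thesis
      using R z by (auto simp: path_image_rectpath)
  qed
  have lim1: "((\<lambda>u. f u / (u - z)) has_contour_integral (2 * pi * \<i> * f z))
      (rectpath (of_real (-R)) (Complex R R))" if "R0 \<le> R" for R
  proof -
    have R: "0 < R" "cmod z < R" using that z by (auto simp: R0_def)
    have "\<bar>Re z\<bar> < R" "Im z < R"
      using abs_Re_le_cmod[of z] abs_Im_le_cmod[of z] R by auto
    then have "z \<in> box (of_real (-R)) (Complex R R)"
      using z by (auto simp: in_box_complex_iff)
    then have "winding_number (rectpath (of_real (-R)) (Complex R R)) z = 1"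
      by (rule winding_number_rectpath)
    moreover have "((\<lambda>u. f u / (u - z)) has_contour_integral
        (2 * pi * \<i> * winding_number (rectpath (of_real (-R)) (Complex R R)) z * f z))
        (rectpath (of_real (-R)) (Complex R R))"
    proof (rule Cauchy_integral_formula_convex_simple[OF _ hol])
      show "z \<in> interior {z. - e < Im z}"
        using z \<open>0 < e\<close> by (simp add: interior_open open_halfspace_Im_gt)
    qed (use rect[OF that] \<open>0 < e\<close> in \<open>auto simp: convex_halfspace_Im_gt\<close>)
    ultimately show ?thesis by simp
  qed
  \<comment> \<open>The pole \<open>cnj z\<close> lies below the real axis, so the integrand is
    holomorphic on a half plane containing the rectangle.\<close>
  have lim2: "((\<lambda>u. f u / (u - cnj z)) has_contour_integral 0)
      (rectpath (of_real (-R)) (Complex R R))" if "R0 \<le> R" for R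
  proof (rule Cauchy_theorem_convex_simple)
    let ?S = "{w. max (-e) (Im (cnj z)) < Im w}"
    show "convex ?S" by (rule convex_halfspace_Im_gt)
    show "(\<lambda>u. f u / (u - cnj z)) holomorphic_on ?S"
      by (intro holomorphic_intros holomorphic_on_subset[OF hol]) auto
    show "path_image (rectpath (complex_of_real (- R)) (Complex R R)) \<subseteq> ?S"
      using rect[OF that] z \<open>0 < e\<close> by auto
  qed auto
  have 1: "integrable lborel (\<lambda>t. f (of_real t) / (of_real t - z))"
      "(\<integral>t. f (of_real t) / (of_real t - z) \<partial>lborel) = 2 * pi * \<i> * f z"
    using z contour_integral_rectpath_real_limit[where h = "\<lambda>u. f u / (u - z)", OF cont bd lim1]
    by auto
  have 2: "integrable lborel (\<lambda>t. f (of_real t) / (of_real t - cnj z))"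
      "(\<integral>t. f (of_real t) / (of_real t - cnj z) \<partial>lborel) = 0"
    using z contour_integral_rectpath_real_limit[where h = "\<lambda>u. f u / (u - cnj z)", OF cont bd lim2]
    by auto
  \<comment> \<open>For real \<open>t\<close>, conjugation turns the kernel at \<open>cnj z\<close>
    into the kernel at \<open>z\<close>.\<close>
  have 3: "integrable lborel (\<lambda>t. cnj (f (of_real t)) / (of_real t - z))"
    using integrable_cnj[OF 2(1)] by simp
  have 4: "(\<integral>t. cnj (f (of_real t)) / (of_real t - z) \<partial>lborel) = 0"
    using arg_cong[OF 2(2), of cnj] by (simp flip: Bochner_Integration.integral_cnj)
  have eq: "of_real (- Im (f (of_real t)) / pi) / (z - of_real t)
      = (f (of_real t) / (of_real t - z) - cnj (f (of_real t)) / (of_real t - z)) / (2 * pi * \<i>)" for t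
  proof -
    have "f (of_real t) - cnj (f (of_real t)) = 2 * \<i> * of_real (Im (f (of_real t)))"
      by (simp add: complex_eq_iff)
    then have "(f (of_real t) / (of_real t - z) - cnj (f (of_real t)) / (of_real t - z)) / (2 * pi * \<i>)
      = (2 * \<i> * of_real (Im (f (of_real t)))) / (of_real t - z) / (2 * pi * \<i>)"
      by (simp flip: diff_divide_distrib)
    also have "\<dots> = of_real (- Im (f (of_real t)) / pi) / (z - of_real t)"
      using ne[of z t] z by (simp add: divide_simps) (simp add: algebra_simps)
    finally show ?thesis ..
  qed
  have i5: "integrable lborel (\<lambda>t. of_real (- Im (f (of_real t)) / pi) / (z - of_real t))"
    unfolding eq using 1 3 by (intro integrable_divide Bochner_Integration.integrable_diff)
  then have "integrable lborel (\<lambda>t. (- of_real pi) * (of_real (- Im (f (of_real t)) / pi) / (z - of_real t)))"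
    by (intro integrable_mult_right)
  then show "integrable lborel (\<lambda>t. of_real (Im (f (of_real t))) / (z - of_real t))"
    by simp
  show "f z = (\<integral>t. of_real (- Im (f (of_real t)) / pi) / (z - of_real t) \<partial>lborel)"
    unfolding eq using 1 3 4 by (simp add: Bochner_Integration.integral_diff)
qed

text \<open>The shift \<open>F (z + \<i> e)\<close> is holomorphic across the real axis, so the half
  plane formula represents it by the nonnegative density \<open>k e\<close> (Stieltjes inversion).
  These densities define probability measures, tight because \<open>z F z\<close> tends to 1
  uniformly in direction; a weak limit as \<open>e\<close> tends to 0 represents \<open>F\<close>.
  The filter expresses the limit at infinity within the open half plane.\<close>

theorem Nevanlinna_Cauchy_transform:
  fixes F :: "complex \<Rightarrow> complex"
  assumes hol: "F holomorphic_on {z. 0 < Im z}"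
    and Im_le: "\<And>z. 0 < Im z \<Longrightarrow> Im (F z) \<le> 0"
    and lim: "((\<lambda>z. z * F z) \<longlongrightarrow> 1) (inf at_infinity (principal {z. 0 < Im z}))"
  obtains \<rho> :: "real measure" where "prob_space \<rho>" "sets \<rho> = sets borel"
    "\<And>z. 0 < Im z \<Longrightarrow> F z = (\<integral>t. 1 / (z - of_real t) \<partial>\<rho>)"
proof -
  have near: "\<exists>b. \<forall>z. b \<le> cmod z \<longrightarrow> 0 < Im z \<longrightarrow> cmod (z * F z - 1) < d" if "0 < d" for d
    using tendstoD[OF lim that] by (auto simp: eventually_inf_principal eventually_at_infinity dist_norm)
  from near[of 1] obtain r where r: "\<And>z. r \<le> cmod z \<Longrightarrow> 0 < Im z \<Longrightarrow> cmod (z * F z - 1) < 1"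
    by auto
  define k where "k e t = - Im (F (of_real t + \<i> * of_real e)) / pi" for e t :: real
  define \<mu> where "\<mu> e = density lborel (\<lambda>t. ennreal (k e t))" for e
  have sets_\<mu> [simp, measurable_cong]: "sets (\<mu> e) = sets borel" for e
    by (simp add: \<mu>_def)
  have k_nonneg: "0 \<le> k e t" if "0 < e" for e t
    using Im_le[of "of_real t + \<i> * of_real e"] that
    by (simp add: k_def divide_nonpos_pos)
  have k_meas: "k e \<in> borel_measurable borel" if "0 < e" for e
    unfolding k_def using that
    by (intro borel_measurable_continuous_onI continuous_intros
        continuous_on_compose2[OF holomorphic_on_imp_continuous_on[OF hol]]) auto
  have rep: "integrable lborel (\<lambda>t. of_real (k e t) / (z - of_real t))"
      "F (z + \<i> * of_real e) = (\<integral>t. of_real (k e t) / (z - of_real t) \<partial>lborel)"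
    if "0 < e" "0 < Im z" for e z
  proof -
    let ?f = "\<lambda>z. F (z + \<i> * of_real e)"
    have "?f = F \<circ> (\<lambda>z. z + \<i> * of_real e)" by auto
    then have hf: "?f holomorphic_on {z. - e < Im z}"
      by (simp only:) (rule holomorphic_on_compose_gen[OF _ hol], auto intro!: holomorphic_intros)
    \<comment> \<open>The threshold \<open>r + e\<close> puts the shifted point \<open>?v\<close>
      where \<open>cmod (?v * F ?v) \<le> 2\<close>, and \<open>2 * e\<close> ensures
      \<open>cmod ?v \<ge> cmod u / 2\<close>; together they give the constant 4.\<close>
    have bd: "cmod (?f u) \<le> 4 / cmod u" if "0 \<le> Im u" "max (max 1 (r + e)) (2 * e) \<le> cmod u" for u
    proof -
      let ?v = "u + \<i> * of_real e"
      have v: "cmod u - e \<le> cmod ?v"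
        using norm_diff_ineq[of u "\<i> * of_real e"] \<open>0 < e\<close> by (simp add: norm_mult)
      have "cmod (?v * F ?v - 1) < 1"
        using that v \<open>0 < e\<close> by (intro r) auto
      then have "cmod (?v * F ?v) \<le> 2"
        using norm_triangle_ineq2[of "?v * F ?v" 1] by simp
      moreover have "cmod u / 2 \<le> cmod ?v" using v that by auto
      ultimately have "cmod u / 2 * cmod (F ?v) \<le> 2"
        by (smt (verit) mult_right_mono norm_ge_zero norm_mult)
      moreover have "0 < cmod u" using that by auto
      ultimately show ?thesis by (simp add: field_simps)
    qed
    have mul: "of_real (k e t) / (z - of_real t)
        = (- 1 / of_real pi) * (of_real (Im (?f (of_real t))) / (z - of_real t))" for t
      by (simp add: k_def)
    show "integrable lborel (\<lambda>t. of_real (k e t) / (z - of_real t))"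
      unfolding mul
      by (intro integrable_mult_right half_plane_Cauchy_Im(1)[OF \<open>0 < e\<close> hf bd \<open>0 < Im z\<close>])
    show "?f z = (\<integral>t. of_real (k e t) / (z - of_real t) \<partial>lborel)"
      unfolding k_def by (rule half_plane_Cauchy_Im(2)[OF \<open>0 < e\<close> hf bd \<open>0 < Im z\<close>])
  qed
  \<comment> \<open>On the imaginary axis the Cauchy kernel yields the weight
    \<open>s\<^sup>2 / (s\<^sup>2 + t\<^sup>2)\<close>, which increases to 1 as \<open>s\<close>
    grows and so measures mass.\<close>
  have kernel: "- s * Im (of_real a / (\<i> * of_real s - of_real t)) = s\<^sup>2 / (s\<^sup>2 + t\<^sup>2) * a" if "0 < s" for s t a
    using that by (simp add: Im_divide power2_eq_square algebra_simps)
  have mass: "integrable lborel (\<lambda>t. s\<^sup>2 / (s\<^sup>2 + t\<^sup>2) * k e t)"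
      "(\<integral>t. s\<^sup>2 / (s\<^sup>2 + t\<^sup>2) * k e t \<partial>lborel) = - s * Im (F (\<i> * of_real (s + e)))"
    if "0 < e" "0 < s" for e s
  proof -
    note rp = rep[OF \<open>0 < e\<close>, of "\<i> * of_real s"]
    have i: "integrable lborel (\<lambda>t. of_real (k e t) / (\<i> * of_real s - of_real t))"
      using rp(1) \<open>0 < s\<close> by simp
    show "integrable lborel (\<lambda>t. s\<^sup>2 / (s\<^sup>2 + t\<^sup>2) * k e t)"
      unfolding kernel[OF \<open>0 < s\<close>, symmetric] by (intro integrable_mult_right integrable_Im i)
    have "F (\<i> * of_real (s + e)) = (\<integral>t. of_real (k e t) / (\<i> * of_real s - of_real t) \<partial>lborel)"
      using rp(2) \<open>0 < s\<close> by (simp add: algebra_simps)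
    then show "(\<integral>t. s\<^sup>2 / (s\<^sup>2 + t\<^sup>2) * k e t \<partial>lborel) = - s * Im (F (\<i> * of_real (s + e)))"
      unfolding kernel[OF \<open>0 < s\<close>, symmetric] using i by (simp add: integral_Im)
  qed
  \<comment> \<open>The bound is uniform in \<open>e \<le> 1\<close>: this is what tightness
    requires. Using the factor \<open>s\<close> instead of \<open>s + e\<close> costs
    \<open>e / (s + e) * ?q\<close>, at most \<open>d / 2\<close> because \<open>?q < 2\<close> and
    \<open>s \<ge> 4 / d\<close>.\<close>
  have a_bound: "\<exists>b. \<forall>s e. b \<le> s \<longrightarrow> 0 < e \<longrightarrow> e \<le> 1 \<longrightarrow> \<bar>- s * Im (F (\<i> * of_real (s + e))) - 1\<bar> < d"
    if "0 < d" for d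
  proof -
    have "0 < min 1 (d / 2)" using that by simp
    from near[OF this] obtain b where b: "\<And>z. b \<le> cmod z \<Longrightarrow> 0 < Im z \<Longrightarrow> cmod (z * F z - 1) < min 1 (d / 2)"
      by auto
    have "\<bar>- s * Im (F (\<i> * of_real (s + e))) - 1\<bar> < d"
      if s: "max (max b 1) (4 / d) \<le> s" and e: "0 < e" "e \<le> 1" for s e
    proof -
      let ?z = "\<i> * of_real (s + e)"
      let ?q = "- (s + e) * Im (F ?z)"
      have "1 \<le> s" "b \<le> s" "4 / d \<le> s" using s by auto
      have "cmod (?z * F ?z - 1) < min 1 (d / 2)"
        using s e by (intro b) (auto simp: norm_mult simp del: of_real_add)
      moreover have "Re (?z * F ?z - 1) = ?q - 1" by (simp add: algebra_simps)
      ultimately have q: "\<bar>?q - 1\<bar> < min 1 (d / 2)"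
        by (metis abs_Re_le_cmod order_le_less_trans)
      have "- s * Im (F ?z) = ?q - e / (s + e) * ?q"
        using \<open>1 \<le> s\<close> e by (simp add: field_simps)
      moreover have "0 \<le> e / (s + e) * ?q" "e / (s + e) * ?q \<le> d / 2"
      proof -
        have "0 < ?q" "?q < 2" using q by (simp_all add: abs_if split: if_splits)
        moreover have "e / (s + e) \<le> d / 4"
        proof -
          have "e / (s + e) \<le> 1 / s" using e \<open>1 \<le> s\<close> by (intro frac_le) auto
          also have "\<dots> \<le> d / 4" using \<open>4 / d \<le> s\<close> \<open>0 < d\<close> \<open>1 \<le> s\<close> by (simp add: field_simps)
          finally show ?thesis .
        qed
        ultimately have "e / (s + e) * ?q \<le> d / 4 * 2"
          using e \<open>1 \<le> s\<close> \<open>0 < d\<close> by (intro mult_mono) auto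
        then show "e / (s + e) * ?q \<le> d / 2" by simp
        show "0 \<le> e / (s + e) * ?q" using e \<open>1 \<le> s\<close> \<open>0 < ?q\<close> by (intro mult_nonneg_nonneg[OF _ less_imp_le]) auto
      qed
      ultimately show ?thesis using q by linarith
    qed
    then show ?thesis by blast
  qed
  \<comment> \<open>Integrability of \<open>k e\<close> is still unknown, so the mass is computed
    with nonnegative integrals: the weights for \<open>s = n + 1\<close> increase to 1, and monotone
    convergence gives the limit of \<open>- s * Im (F (\<i> (s + e)))\<close>, which is 1.\<close>
  have prob: "prob_space (\<mu> e)" if e: "0 < e" "e \<le> 1" for e
  proof
    let ?w = "\<lambda>n t. (of_nat (Suc n))\<^sup>2 / ((of_nat (Suc n))\<^sup>2 + t\<^sup>2) :: real"
    have w_mono: "incseq (\<lambda>n. ennreal (?w n t * k e t))" for t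
    proof (rule incseq_SucI)
      fix n
      have "?w n t \<le> ?w (Suc n) t"
      proof -
        have frac_mono: "a / (a + c) \<le> b / (b + c)" if "0 < a" "a \<le> b" "0 \<le> c" for a b c :: real
          using that mult_right_mono[of a b c] by (simp add: divide_simps) (simp add: algebra_simps)
        show ?thesis by (rule frac_mono) (auto intro!: power_mono simp del: of_nat_Suc)
      qed
      then show "ennreal (?w n t * k e t) \<le> ennreal (?w (Suc n) t * k e t)"
        using k_nonneg[OF e(1)] by (intro ennreal_leI mult_right_mono)
    qed
    have w_lim: "(SUP n. ennreal (?w n t * k e t)) = ennreal (k e t)" for t
    proof (rule LIMSEQ_unique[OF LIMSEQ_SUP[OF w_mono]])
      have "(\<lambda>n. ?w n t) \<longlonglongrightarrow> 1" by real_asymp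
      then have "(\<lambda>n. ?w n t * k e t) \<longlonglongrightarrow> 1 * k e t" by (intro tendsto_intros)
      then show "(\<lambda>n. ennreal (?w n t * k e t)) \<longlonglongrightarrow> ennreal (k e t)" by (simp add: tendsto_ennrealI)
    qed
    have int_w: "(\<lambda>n. \<integral>\<^sup>+t. ennreal (?w n t * k e t) \<partial>lborel)
        = (\<lambda>n. ennreal (- of_nat (Suc n) * Im (F (\<i> * of_real (of_nat (Suc n) + e)))))"
    proof
      fix n
      have "(\<integral>\<^sup>+t. ennreal (?w n t * k e t) \<partial>lborel) = ennreal (\<integral>t. ?w n t * k e t \<partial>lborel)"
        using k_nonneg[OF e(1)] by (intro nn_integral_eq_integral mass(1) e AE_I2 mult_nonneg_nonneg) auto
      then show "(\<integral>\<^sup>+t. ennreal (?w n t * k e t) \<partial>lborel)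
          = ennreal (- of_nat (Suc n) * Im (F (\<i> * of_real (of_nat (Suc n) + e))))"
        by (subst (asm) mass(2)) (use e in auto)
    qed
    have "emeasure (\<mu> e) (space (\<mu> e)) = (\<integral>\<^sup>+t. ennreal (k e t) \<partial>lborel)"
      using k_meas[OF e(1)] by (simp add: \<mu>_def emeasure_density)
    also have "\<dots> = (SUP n. \<integral>\<^sup>+t. ennreal (?w n t * k e t) \<partial>lborel)"
      unfolding w_lim[symmetric]
      using k_meas[OF e(1)] w_mono by (intro nn_integral_monotone_convergence_SUP) (auto simp: incseq_def le_fun_def)
    also note int_w
    finally have em: "emeasure (\<mu> e) (space (\<mu> e)) = (SUP n. ennreal (- of_nat (Suc n) * Im (F (\<i> * of_real (of_nat (Suc n) + e)))))" .
    show "emeasure (\<mu> e) (space (\<mu> e)) = 1"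
      unfolding em
    proof (rule LIMSEQ_unique[OF LIMSEQ_SUP])
      let ?a = "\<lambda>n. - of_nat (Suc n) * Im (F (\<i> * of_real (of_nat (Suc n) + e)))"
      show "incseq (\<lambda>n. ennreal (?a n))"
        unfolding int_w[symmetric] using w_mono by (intro incseq_SucI nn_integral_mono) (auto simp: incseq_Suc_iff)
      have "?a \<longlonglongrightarrow> 1"
      proof (rule LIMSEQ_I)
        fix d :: real assume "0 < d"
        with a_bound obtain b where b: "\<And>s. b \<le> s \<Longrightarrow> \<bar>- s * Im (F (\<i> * of_real (s + e))) - 1\<bar> < d"
          using e by blast
        have "norm (?a n - 1) < d" if "nat \<lceil>b\<rceil> \<le> n" for n
        proof -
          have "b \<le> of_nat (Suc n)" using that by linarith
          from b[OF this] show ?thesis by simp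
        qed
        then show "\<exists>N. \<forall>n\<ge>N. norm (?a n - 1) < d" by blast
      qed
      then show "(\<lambda>n. ennreal (?a n)) \<longlonglongrightarrow> 1"
        using tendsto_ennrealI by fastforce
    qed
  qed
  \<comment> \<open>Compactness of measures is available for sequences; \<open>Suc n\<close> keeps
    the shift positive and at most 1.\<close>
  define \<nu> where "\<nu> n = \<mu> (1 / of_nat (Suc n))" for n
  have real_dist: "real_distribution (\<mu> e)" if "0 < e" "e \<le> 1" for e
    using prob[OF that] by (simp add: real_distribution_def real_distribution_axioms_def)
  then have \<nu>_dist: "real_distribution (\<nu> n)" for n
    by (simp add: \<nu>_def)
  \<comment> \<open>A Chebyshev bound: the weight is at most 1 on the interval and at most 1/2 off
    it, where \<open>\<bar>t\<bar> \<ge> s\<close>. The half-open interval matches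
    \<open>tight_def\<close>.\<close>
  have central_mass: "2 * (- s * Im (F (\<i> * of_real (s + e)))) - 1 \<le> measure (\<mu> e) {-2 * s<..2 * s}"
    if "0 < e" "e \<le> 1" "0 < s" for e s
  proof -
    interpret real_distribution "\<mu> e" using real_dist that by blast
    have "- s * Im (F (\<i> * of_real (s + e))) = (\<integral>t. s\<^sup>2 / (s\<^sup>2 + t\<^sup>2) \<partial>\<mu> e)"
      unfolding \<mu>_def mass(2)[OF that(1,3), symmetric]
      using k_meas[OF that(1)] k_nonneg[OF that(1)]
      by (subst integral_density) (auto simp: mult.commute)
    also have "\<dots> \<le> (\<integral>t. 1 / 2 + indicator {-2 * s<..2 * s} t / 2 \<partial>\<mu> e)"
    proof (rule integral_mono)
      have nonneg: "0 \<le> s\<^sup>2 / (s\<^sup>2 + t\<^sup>2)" "s\<^sup>2 / (s\<^sup>2 + t\<^sup>2) \<le> 1" for t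
        using that by (auto simp: divide_simps add_pos_nonneg)
      then show "integrable (\<mu> e) (\<lambda>t. s\<^sup>2 / (s\<^sup>2 + t\<^sup>2))"
        by (intro integrable_const_bound[of _ 1]) auto
      show "integrable (\<mu> e) (\<lambda>t. 1 / 2 + indicator {-2 * s<..2 * s} t / 2 :: real)"
        by (intro Bochner_Integration.integrable_add integrable_divide) (auto simp: emeasure_eq_measure)
      show "s\<^sup>2 / (s\<^sup>2 + t\<^sup>2) \<le> 1 / 2 + indicator {-2 * s<..2 * s} t / 2" for t
      proof (cases "t \<in> {-2 * s<..2 * s}")
        case False
        then have "s \<le> \<bar>t\<bar>" using that by auto
        then have "s\<^sup>2 \<le> t\<^sup>2" using that by (metis abs_le_square_iff abs_of_pos)
        then show ?thesis using that by (auto simp: divide_simps add_pos_nonneg indicator_def)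
      qed (use nonneg in auto)
    qed
    also have "\<dots> = 1 / 2 + measure (\<mu> e) {-2 * s<..2 * s} / 2"
      by (subst Bochner_Integration.integral_add)
        (auto simp: emeasure_eq_measure prob_space[simplified])
    finally show ?thesis by simp
  qed
  have "tight \<nu>"
    unfolding tight_def
  proof (intro conjI allI impI \<nu>_dist)
    fix d :: real assume "0 < d"
    then obtain b where b: "\<And>s e. b \<le> s \<Longrightarrow> 0 < e \<Longrightarrow> e \<le> 1 \<Longrightarrow>
        \<bar>- s * Im (F (\<i> * of_real (s + e))) - 1\<bar> < d / 2"
      using a_bound[of "d / 2"] by auto
    let ?s = "max b 1"
    have "1 - d < measure (\<nu> n) {-2 * ?s<..2 * ?s}" for n
    proof -
      let ?e = "1 / of_nat (Suc n) :: real"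
      have e: "0 < ?e" "?e \<le> 1" by auto
      have "\<bar>- ?s * Im (F (\<i> * of_real (?s + ?e))) - 1\<bar> < d / 2"
        using e by (intro b) auto
      moreover have "2 * (- ?s * Im (F (\<i> * of_real (?s + ?e)))) - 1 \<le> measure (\<nu> n) {-2 * ?s<..2 * ?s}"
        unfolding \<nu>_def using e by (intro central_mass) auto
      ultimately show ?thesis unfolding abs_less_iff by argo
    qed
    then show "\<exists>a b. a < b \<and> (\<forall>n. 1 - d < measure (\<nu> n) {a<..b})"
      by (intro exI[of _ "-2 * ?s"] exI[of _ "2 * ?s"]) auto
  qed
  from tight_imp_convergent_subsubsequence[OF this strict_mono_id]
  obtain q M where q: "strict_mono q" and M: "real_distribution M" and conv: "weak_conv_m (\<nu> \<circ> q) M"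
    by auto
  interpret M: real_distribution M by (rule M)
  \<comment> \<open>Both sides are limits of \<open>F (z + \<i> / (q n + 1))\<close>: one by weak
    convergence, since the kernel is continuous and bounded by \<open>1 / Im z\<close>, the other by
    continuity of \<open>F\<close>.\<close>
  have "F z = (\<integral>t. 1 / (z - of_real t) \<partial>M)" if z: "0 < Im z" for z
  proof (rule LIMSEQ_unique)
    have z_ne: "z - of_real t \<noteq> 0" for t :: real
      using z by (auto simp: complex_eq_iff)
    have "(\<lambda>n. \<integral>t. 1 / (z - of_real t) \<partial>(\<nu> \<circ> q) n) \<longlonglongrightarrow> (\<integral>t. 1 / (z - of_real t) \<partial>M)"
    proof (rule weak_conv_imp_integral_bdd_continuous_conv[OF _ M conv])
      show "real_distribution ((\<nu> \<circ> q) n)" for n by (simp add: \<nu>_dist)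
      show "isCont (\<lambda>t. 1 / (z - complex_of_real t)) t" for t
        using z_ne by (intro continuous_intros) auto
      show "cmod (1 / (z - complex_of_real t)) \<le> 1 / Im z" for t
        using z abs_Im_le_cmod[of "z - of_real t"] by (simp add: norm_divide frac_le)
    qed
    moreover have "(\<integral>t. 1 / (z - of_real t) \<partial>(\<nu> \<circ> q) n) = F (z + \<i> * of_real (1 / of_nat (Suc (q n))))" for n
    proof -
      let ?e = "1 / of_nat (Suc (q n)) :: real"
      have "0 < ?e" by simp
      have "(\<integral>t. 1 / (z - of_real t) \<partial>(\<nu> \<circ> q) n) = (\<integral>t. k ?e t *\<^sub>R (1 / (z - of_real t)) \<partial>lborel)"
        unfolding \<nu>_def \<mu>_def o_def
        using k_meas[OF \<open>0 < ?e\<close>] k_nonneg[OF \<open>0 < ?e\<close>]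
        by (intro integral_density) (auto simp: z_ne intro!: borel_measurable_continuous_onI continuous_intros)
      also have "\<dots> = F (z + \<i> * of_real ?e)"
        unfolding rep(2)[OF \<open>0 < ?e\<close> z] by (simp add: scaleR_conv_of_real)
      finally show ?thesis .
    qed
    ultimately show "(\<lambda>n. F (z + \<i> * of_real (1 / of_nat (Suc (q n))))) \<longlonglongrightarrow> (\<integral>t. 1 / (z - of_real t) \<partial>M)"
      by simp
    have "isCont F z"
      using holomorphic_on_imp_continuous_on[OF hol] z
      by (simp add: continuous_on_eq_continuous_at open_halfspace_Im_gt)
    moreover have "(\<lambda>n. z + \<i> * of_real (1 / of_nat (Suc (q n)))) \<longlonglongrightarrow> z"
    proof -
      have "(\<lambda>n. 1 / of_nat (Suc n) :: real) \<longlonglongrightarrow> 0" by real_asymp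
      from LIMSEQ_subseq_LIMSEQ[OF this q] have "(\<lambda>n. 1 / of_nat (Suc (q n)) :: real) \<longlonglongrightarrow> 0"
        by (simp add: o_def)
      then have "(\<lambda>n. z + \<i> * of_real (1 / of_nat (Suc (q n)))) \<longlonglongrightarrow> z + \<i> * of_real 0"
        by (intro tendsto_intros)
      then show ?thesis by simp
    qed
    ultimately show "(\<lambda>n. F (z + \<i> * of_real (1 / of_nat (Suc (q n))))) \<longlonglongrightarrow> F z"
      by (rule isCont_tendsto_compose)
  qed
  then show ?thesis
    using that M.prob_space_axioms M.events_eq_borel by blast
qed

text \<open>Taking imaginary parts under the integral gives \<open>1 - p * (\<integral>t. 1 /
  (\<delta>\<^sup>2 + t\<^sup>2) \<partial>\<rho>)\<close>. Its integrand is strictly decreasing in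
  \<open>\<delta>\<close> for every \<open>t\<close> and bounded by
  \<open>1 / \<delta>\<^sup>2\<close>.\<close>

lemma
  fixes \<rho> :: "real measure" and p :: real
  assumes "prob_space \<rho>" and sets: "sets \<rho> = sets borel" and "p > 0"
  shows Im_Cauchy_transform_strict_mono:
      "strict_mono_on {0<..} (\<lambda>\<delta>::real. Im (\<i> * of_real \<delta> + of_real p * (\<integral>t. 1 / (\<i> * of_real \<delta> - of_real t) \<partial>\<rho>)) / \<delta>)"
    and Im_Cauchy_transform_tendsto:
      "((\<lambda>\<delta>::real. Im (\<i> * of_real \<delta> + of_real p * (\<integral>t. 1 / (\<i> * of_real \<delta> - of_real t) \<partial>\<rho>)) / \<delta>) \<longlongrightarrow> 1) at_top"
proof -
  interpret prob_space \<rho> by fact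
  note [measurable_cong] = sets
  let ?h = "\<lambda>\<delta>::real. Im (\<i> * of_real \<delta> + of_real p * (\<integral>t. 1 / (\<i> * of_real \<delta> - of_real t) \<partial>\<rho>)) / \<delta>"
  have bound: "0 < 1 / (\<delta>\<^sup>2 + t\<^sup>2)" "1 / (\<delta>\<^sup>2 + t\<^sup>2) \<le> 1 / \<delta>\<^sup>2" if "0 < \<delta>" for \<delta> t :: real
    using that by (auto simp: add_pos_nonneg intro!: divide_left_mono mult_pos_pos)
  have int: "integrable \<rho> (\<lambda>t. 1 / (\<delta>\<^sup>2 + t\<^sup>2))" if "0 < \<delta>" for \<delta> :: real
    by (rule integrable_const_bound[of _ "1 / \<delta>\<^sup>2"])
      (use bound[OF that] in \<open>auto simp: less_imp_le abs_of_pos\<close>)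
  have h: "?h \<delta> = 1 - p * (\<integral>t. 1 / (\<delta>\<^sup>2 + t\<^sup>2) \<partial>\<rho>)" if "0 < \<delta>" for \<delta>
  proof -
    have "integrable \<rho> (\<lambda>t. 1 / (\<i> * of_real \<delta> - complex_of_real t))"
    proof (rule integrable_const_bound[of _ "1 / \<delta>"])
      show "AE t in \<rho>. cmod (1 / (\<i> * of_real \<delta> - complex_of_real t)) \<le> 1 / \<delta>"
      proof (intro AE_I2)
        fix t
        show "cmod (1 / (\<i> * of_real \<delta> - complex_of_real t)) \<le> 1 / \<delta>"
          using abs_Im_le_cmod[of "\<i> * of_real \<delta> - complex_of_real t"] that
          by (simp add: norm_divide frac_le)
      qed
    qed measurable
    then have "Im (\<integral>t. 1 / (\<i> * of_real \<delta> - complex_of_real t) \<partial>\<rho>)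
        = (\<integral>t. Im (1 / (\<i> * of_real \<delta> - complex_of_real t)) \<partial>\<rho>)"
      by simp
    also have "(\<lambda>t. Im (1 / (\<i> * of_real \<delta> - complex_of_real t))) = (\<lambda>t. - \<delta> * (1 / (\<delta>\<^sup>2 + t\<^sup>2)))"
      using that by (simp add: Im_divide power2_eq_square fun_eq_iff algebra_simps)
    finally have "Im (\<integral>t. 1 / (\<i> * of_real \<delta> - complex_of_real t) \<partial>\<rho>)
        = - \<delta> * (\<integral>t. 1 / (\<delta>\<^sup>2 + t\<^sup>2) \<partial>\<rho>)"
      by (simp only: integral_mult_right_zero)
    then show ?thesis using that by (simp add: field_simps)
  qed
  show "strict_mono_on {0<..} ?h"
  proof (rule strict_mono_onI)
    fix r s :: real assume rs: "r \<in> {0<..}" "s \<in> {0<..}" "r < s"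
    have "(\<integral>t. 1 / (s\<^sup>2 + t\<^sup>2) \<partial>\<rho>) < (\<integral>t. 1 / (r\<^sup>2 + t\<^sup>2) \<partial>\<rho>)"
    proof (rule integral_less_AE_space)
      show "AE t in \<rho>. 1 / (s\<^sup>2 + t\<^sup>2) < 1 / (r\<^sup>2 + t\<^sup>2)"
        using rs by (intro AE_I2 divide_strict_left_mono add_strict_right_mono power_strict_mono)
          (auto simp: add_pos_nonneg)
      show "emeasure \<rho> (space \<rho>) \<noteq> 0" by (simp add: emeasure_space_1)
    qed (use int rs in auto)
    then show "?h r < ?h s"
      using rs \<open>p > 0\<close> by (simp only: h greaterThan_iff) simp
  qed
  have "((\<lambda>\<delta>. 1 - p * (\<integral>t. 1 / (\<delta>\<^sup>2 + t\<^sup>2) \<partial>\<rho>)) \<longlongrightarrow> 1 - p * 0) at_top"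
  proof (intro tendsto_intros, rule tendsto_sandwich)
    show "\<forall>\<^sub>F \<delta> in at_top. 0 \<le> (\<integral>t. 1 / (\<delta>\<^sup>2 + t\<^sup>2) \<partial>\<rho>)"
      by (auto intro!: always_eventually Bochner_Integration.integral_nonneg)
    show "\<forall>\<^sub>F \<delta> in at_top. (\<integral>t. 1 / (\<delta>\<^sup>2 + t\<^sup>2) \<partial>\<rho>) \<le> 1 / \<delta>\<^sup>2"
      using eventually_gt_at_top[of 0]
    proof eventually_elim
      case (elim \<delta>)
      then show ?case using integral_le_const[OF int[OF elim]] bound(2) by (auto intro: AE_I2)
    qed
    show "((\<lambda>\<delta>::real. 1 / \<delta>\<^sup>2) \<longlongrightarrow> 0) at_top" by real_asymp
  qed auto
  then have "((\<lambda>\<delta>. 1 - p * (\<integral>t. 1 / (\<delta>\<^sup>2 + t\<^sup>2) \<partial>\<rho>)) \<longlongrightarrow> 1) at_top" by simp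
  moreover have "\<forall>\<^sub>F \<delta> in at_top. 1 - p * (\<integral>t. 1 / (\<delta>\<^sup>2 + t\<^sup>2) \<partial>\<rho>) = ?h \<delta>"
    using eventually_gt_at_top[of 0] by eventually_elim (simp only: h)
  ultimately show "(?h \<longlongrightarrow> 1) at_top" by (rule Lim_transform_eventually)
qed

section \<open>The transform \<open>H\<close>\<close>

lemma matrix_inv_eqI:
  fixes A B :: "'a::semiring_1 ^ 'n ^ 'n"
  assumes "A ** B = mat 1" "B ** A = mat 1"
  shows "matrix_inv A = B"
proof -
  have "A ** matrix_inv A = mat 1 \<and> matrix_inv A ** A = mat 1"
    unfolding matrix_inv_def by (rule someI_ex) (use assms in blast)
  then have "B ** A ** matrix_inv A = B"
    by (simp add: matrix_mul_rid flip: matrix_mul_assoc)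
  then show ?thesis
    using assms(2) by (simp add: matrix_mul_lid)
qed

text \<open>Both products are checked entrywise because the entries may fail to commute; the rule
  then serves matrices over the algebra as well as complex ones.\<close>

lemma matrix_inv_2I:
  fixes m11 m12 m21 m22 n11 n12 n21 n22 :: "'a::semiring_1"
  assumes "m11 * n11 + m12 * n21 = 1" "m11 * n12 + m12 * n22 = 0"
    "m21 * n11 + m22 * n21 = 0" "m21 * n12 + m22 * n22 = 1"
    and "n11 * m11 + n12 * m21 = 1" "n11 * m12 + n12 * m22 = 0"
    "n21 * m11 + n22 * m21 = 0" "n21 * m12 + n22 * m22 = 1"
  shows "matrix_inv (vector [vector [m11, m12], vector [m21, m22]] :: 'a^2^2)
    = vector [vector [n11, n12], vector [n21, n22]]"
  by (rule matrix_inv_eqI)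
    (simp_all add: assms vec_eq_iff matrix_matrix_mult_def sum_2 forall_2 mat_def vector_2)

lemma matrix_inv_2_11:
  fixes M :: "'a::field^2^2"
  assumes "M$1$1 * M$2$2 - M$1$2 * M$2$1 \<noteq> 0"
  shows "matrix_inv M $ 1 $ 1 = M$2$2 / (M$1$1 * M$2$2 - M$1$2 * M$2$1)"
proof -
  define d where "d = M$1$1 * M$2$2 - M$1$2 * M$2$1"
  have d: "d \<noteq> 0" using assms by (simp add: d_def)
  have M: "M = vector [vector [M$1$1, M$1$2], vector [M$2$1, M$2$2]]"
    by (simp add: vec_eq_iff forall_2 vector_2)
  have "matrix_inv (vector [vector [M$1$1, M$1$2], vector [M$2$1, M$2$2]] :: 'a^2^2)
      = vector [vector [M$2$2 / d, - (M$1$2) / d], vector [- (M$2$1) / d, M$1$1 / d]]"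
    by (rule matrix_inv_2I; use d in \<open>simp add: field_simps\<close>; simp add: d_def algebra_simps)
  then show ?thesis
    by (subst M) (simp add: vector_2 d_def)
qed

text \<open>With \<open>r\<close> and \<open>s\<close> the real and imaginary part of
  \<open>lam\<close>, this rewrites \<open>a * star a\<close> into the form handled by
  \<open>selfadjoint_square_resolvent_set\<close>.\<close>

lemma normal_translate_square:
  fixes x :: "'a::cstar_algebra"
  shows "(x - cscale r 1) * (x - cscale r 1) + cscale (s * s) 1
    = (cscale (r + \<i> * s) 1 - x) * (cscale (r - \<i> * s) 1 - x)"
  by (simp add: cstar_simps algebra_simps)

text \<open>Boundedness is a separate assumption next to \<open>state\<close>; it will be supplied
  by normality.\<close>

locale faithful_state_setting =
  fixes \<phi> :: "'a::cstar_algebra \<Rightarrow> complex" and x :: 'a and lam :: complex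
  assumes \<phi>_bounded: "bounded_clinear_functional \<phi>"
    and \<phi>_state: "state \<phi>"
    and \<phi>_faithful: "faithful \<phi>"
    and x_selfadjoint: "selfadjoint x"
begin

section \<open>The normal element \<open>a\<close> and the entries of \<open>G\<close>\<close>

definition a :: 'a where "a = cscale lam 1 - x"

definition R :: "complex \<Rightarrow> 'a" where "R \<zeta> = resolvent (a * star a) (\<zeta>\<^sup>2)"

lemma star_a: "star a = cscale (cnj lam) 1 - x"
  using x_selfadjoint by (simp add: a_def selfadjoint_def cstar_simps)

lemma a_normal: "star a * a = a * star a"
  unfolding star_a by (simp add: a_def cstar_simps algebra_simps mult.commute)

lemma square_in_resolvent_set:
  assumes "Im \<zeta> > 0"
  shows "\<zeta>\<^sup>2 \<in> resolvent_set (a * star a)"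
proof -
  define b where "b = x - cscale (of_real (Re lam)) 1"
  have "selfadjoint b"
    using x_selfadjoint by (simp add: b_def selfadjoint_def cstar_simps)
  moreover have "\<zeta>\<^sup>2 \<notin> \<real>\<^sub>\<ge>\<^sub>0"
  proof
    assume "\<zeta>\<^sup>2 \<in> \<real>\<^sub>\<ge>\<^sub>0"
    then have "Re \<zeta> * Im \<zeta> = 0" "(Im \<zeta>)\<^sup>2 \<le> (Re \<zeta>)\<^sup>2"
      by (auto simp: complex_nonneg_Reals_iff power2_eq_square)
    then show False using assms by auto
  qed
  ultimately have "\<zeta>\<^sup>2 \<in> resolvent_set (b * b + cscale (of_real ((Im lam)\<^sup>2)) 1)"
    by (rule selfadjoint_square_resolvent_set)
  also have "b * b + cscale (of_real ((Im lam)\<^sup>2)) 1 = a * star a"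
  proof -
    have "lam = of_real (Re lam) + \<i> * of_real (Im lam)" "cnj lam = of_real (Re lam) - \<i> * of_real (Im lam)"
      by (simp_all add: complex_eq_iff)
    then have "a = cscale (of_real (Re lam) + \<i> * of_real (Im lam)) 1 - x"
      "star a = cscale (of_real (Re lam) - \<i> * of_real (Im lam)) 1 - x"
      using a_def star_a by metis+
    then show ?thesis
      using normal_translate_square[of x "of_real (Re lam)" "of_real (Im lam)"]
      by (simp add: b_def power2_eq_square)
  qed
  finally show ?thesis .
qed

lemma R_inverse:
  assumes "Im \<zeta> > 0"
  shows "cscale (\<zeta>\<^sup>2) (R \<zeta>) - a * star a * R \<zeta> = 1"
    and "R \<zeta> * a = a * R \<zeta>" "R \<zeta> * star a = star a * R \<zeta>"
proof -
  note res = square_in_resolvent_set[OF assms]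
  show "cscale (\<zeta>\<^sup>2) (R \<zeta>) - a * star a * R \<zeta> = 1"
    using resolvent_inverse(1)[OF res] by (simp add: R_def left_diff_distrib mult_cscale_left)
  have "a * (a * star a) = (a * star a) * a"
    by (simp add: a_normal mult.assoc)
  moreover have "star a * (a * star a) = (a * star a) * star a"
    by (simp add: a_normal flip: mult.assoc)
  ultimately show "R \<zeta> * a = a * R \<zeta>" "R \<zeta> * star a = star a * R \<zeta>"
    by (simp_all add: R_def resolvent_commute[OF res])
qed

text \<open>Normality of \<open>a\<close> makes \<open>R \<zeta>\<close> commute with
  \<open>a\<close> and \<open>star a\<close>, so the adjugate formula for commuting entries applies,
  with \<open>R \<zeta>\<close> as the inverse of the determinant
  \<open>\<zeta>\<^sup>2 - a * star a\<close>.\<close>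

lemma G_entries:
  assumes "Im \<zeta> > 0"
  shows "G \<phi> x (Bmat lam \<zeta>) $ 1 $ 1 = \<zeta> * \<phi> (R \<zeta>)"
    and "G \<phi> x (Bmat lam \<zeta>) $ 2 $ 2 = \<zeta> * \<phi> (R \<zeta>)"
    and "G \<phi> x (Bmat lam \<zeta>) $ 1 $ 2 = - \<phi> (a * R \<zeta>)"
    and "G \<phi> x (Bmat lam \<zeta>) $ 2 $ 1 = - \<phi> (star a * R \<zeta>)"
proof -
  interpret bounded_linear \<phi>
    using \<phi>_bounded by (simp add: bounded_clinear_functional_def)
  have scale: "\<phi> (cscale k u) = k * \<phi> u" for k u
    using \<phi>_bounded by (simp add: bounded_clinear_functional_def clinear_functional_def)
  note R = R_inverse[OF assms]
  define N :: "'a^2^2" where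
    "N = vector [vector [cscale \<zeta> (R \<zeta>), - (a * R \<zeta>)], vector [- (star a * R \<zeta>), cscale \<zeta> (R \<zeta>)]]"
  have B: "scalar_mat (Bmat lam \<zeta>) - Xmat x = vector [vector [cscale \<zeta> 1, a], vector [star a, cscale \<zeta> 1]]"
    unfolding star_a unfolding a_def
    by (simp add: vec_eq_iff forall_2 vector_2 scalar_mat_def Bmat_def Xmat_def)
  have 1: "cscale (\<zeta> * \<zeta>) (R \<zeta>) - a * (star a * R \<zeta>) = 1"
    using R(1) by (simp add: power2_eq_square mult.assoc)
  have 2: "star a * (a * R \<zeta>) = a * (star a * R \<zeta>)"
    using a_normal by (simp flip: mult.assoc)
  have "matrix_inv (scalar_mat (Bmat lam \<zeta>) - Xmat x) = N"
    unfolding B N_def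
  proof (rule matrix_inv_2I)
    show "cscale \<zeta> 1 * cscale \<zeta> (R \<zeta>) + a * - (star a * R \<zeta>) = 1"
      "star a * - (a * R \<zeta>) + cscale \<zeta> 1 * cscale \<zeta> (R \<zeta>) = 1"
      "cscale \<zeta> (R \<zeta>) * cscale \<zeta> 1 + - (a * R \<zeta>) * star a = 1"
      "- (star a * R \<zeta>) * a + cscale \<zeta> (R \<zeta>) * cscale \<zeta> 1 = 1"
      using 1 by (simp_all add: mult_cscale_left mult_cscale_right cscale_cscale mult.assoc R(2,3) 2)
    show "cscale \<zeta> 1 * - (a * R \<zeta>) + a * cscale \<zeta> (R \<zeta>) = 0"
      "star a * cscale \<zeta> (R \<zeta>) + cscale \<zeta> 1 * - (star a * R \<zeta>) = 0"
      "cscale \<zeta> (R \<zeta>) * a + - (a * R \<zeta>) * cscale \<zeta> 1 = 0"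
      "- (star a * R \<zeta>) * cscale \<zeta> 1 + cscale \<zeta> (R \<zeta>) * star a = 0"
      by (simp_all add: mult_cscale_left mult_cscale_right cscale_minus_right R(2,3))
  qed
  then show "G \<phi> x (Bmat lam \<zeta>) $ 1 $ 1 = \<zeta> * \<phi> (R \<zeta>)"
    "G \<phi> x (Bmat lam \<zeta>) $ 2 $ 2 = \<zeta> * \<phi> (R \<zeta>)"
    "G \<phi> x (Bmat lam \<zeta>) $ 1 $ 2 = - \<phi> (a * R \<zeta>)"
    "G \<phi> x (Bmat lam \<zeta>) $ 2 $ 1 = - \<phi> (star a * R \<zeta>)"
    by (simp_all add: G_def Emat_def N_def vector_2 scale neg)
qed

text \<open>With \<open>u = (B - X)\<^sup>-\<^sup>1 v\<close> the form is \<open>\<langle>v, u\<rangle> = \<langle>(B - X) u, u\<rangle>\<close>, whose imaginary part is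
  \<open>- Im \<zeta> (\<phi> (u\<^sub>1\<^sup>* u\<^sub>1) + \<phi> (u\<^sub>2\<^sup>* u\<^sub>2))\<close>.\<close>

lemma Im_G_form_neg:
  assumes "Im \<zeta> > 0" and v: "v1 \<noteq> 0 \<or> v2 \<noteq> 0"
  shows "Im (cnj v1 * (\<zeta> * \<phi> (R \<zeta>) * v1 - \<phi> (a * R \<zeta>) * v2)
           + cnj v2 * (\<zeta> * \<phi> (R \<zeta>) * v2 - \<phi> (star a * R \<zeta>) * v1)) < 0"
proof -
  interpret bounded_linear \<phi>
    using \<phi>_bounded by (simp add: bounded_clinear_functional_def)
  have scale: "\<phi> (cscale k u) = k * \<phi> u" for k u
    using \<phi>_bounded by (simp add: bounded_clinear_functional_def clinear_functional_def)
  note R = R_inverse[OF assms(1)]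
  define u1 where "u1 = cscale v1 (cscale \<zeta> (R \<zeta>)) - cscale v2 (a * R \<zeta>)"
  define u2 where "u2 = cscale v2 (cscale \<zeta> (R \<zeta>)) - cscale v1 (star a * R \<zeta>)"
  have 1: "cscale (\<zeta> * \<zeta>) (R \<zeta>) = 1 + a * (star a * R \<zeta>)"
    using R(1) by (simp add: diff_eq_eq power2_eq_square mult.assoc)
  have 2: "star a * (a * R \<zeta>) = a * (star a * R \<zeta>)"
    using a_normal by (simp flip: mult.assoc)
  have sq: "cscale \<zeta> (cscale v (cscale \<zeta> (R \<zeta>))) = cscale v (cscale (\<zeta> * \<zeta>) (R \<zeta>))" for v
    by (simp add: cscale_cscale mult_ac)
  \<comment> \<open>\<open>V1\<close> and \<open>V2\<close> are the two rows of
    \<open>(B - X) u = v\<close>.\<close>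
  have V1: "cscale \<zeta> u1 + a * u2 = cscale v1 1"
    unfolding u1_def u2_def cscale_diff_right sq 1
    by (simp add: cstar_simps algebra_simps mult_ac)
  have V2: "star a * u1 + cscale \<zeta> u2 = cscale v2 1"
    unfolding u1_def u2_def cscale_diff_right sq 1
    by (simp add: cstar_simps algebra_simps 2 mult_ac)
  have "cnj v1 * (\<zeta> * \<phi> (R \<zeta>) * v1 - \<phi> (a * R \<zeta>) * v2)
      + cnj v2 * (\<zeta> * \<phi> (R \<zeta>) * v2 - \<phi> (star a * R \<zeta>) * v1)
      = \<phi> (star (cscale v1 1) * u1 + star (cscale v2 1) * u2)"
    by (simp add: star_cscale mult_cscale_left add scale)
      (simp add: u1_def u2_def diff scale algebra_simps)
  \<comment> \<open>The off-diagonal terms form an element plus its adjoint, whose image under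
    \<open>\<phi>\<close> is real; only the \<open>cnj \<zeta>\<close> term has an imaginary
    part.\<close>
  also have "star (cscale v1 1) * u1 + star (cscale v2 1) * u2
      = cscale (cnj \<zeta>) (star u1 * u1 + star u2 * u2) + (star u1 * (a * u2) + star (star u1 * (a * u2)))"
    unfolding V1[symmetric] V2[symmetric] by (simp add: cstar_simps algebra_simps)
  also have "Im (\<phi> \<dots>) = - Im \<zeta> * (Re (\<phi> (star u1 * u1)) + Re (\<phi> (star u2 * u2)))"
  proof -
    have "Im (\<phi> (star u * u)) = 0" for u
      using \<phi>_state by (simp add: state_def complex_nonneg_Reals_iff)
    then show ?thesis
      unfolding add scale state_star[OF \<phi>_state, of "star u1 * (a * u2)"]
      by (simp add: algebra_simps)
  qed
  also have "\<dots> < 0"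
  proof -
    have "0 \<le> Re (\<phi> (star u * u))" for u
      using \<phi>_state by (simp add: state_def complex_nonneg_Reals_iff)
    moreover have "0 < Re (\<phi> (star u * u))" if "u \<noteq> 0" for u
    proof -
      have "\<phi> (star u * u) \<in> \<real>\<^sub>\<ge>\<^sub>0" "\<phi> (star u * u) \<noteq> 0"
        using \<phi>_state \<phi>_faithful that unfolding state_def faithful_def by blast+
      then show ?thesis
        by (auto simp: complex_nonneg_Reals_iff complex_eq_iff)
    qed
    moreover have "u1 \<noteq> 0 \<or> u2 \<noteq> 0"
    proof (rule ccontr)
      assume "\<not> (u1 \<noteq> 0 \<or> u2 \<noteq> 0)"
      then show False using V1 V2 v by simp
    qed
    ultimately have "0 < Re (\<phi> (star u1 * u1)) + Re (\<phi> (star u2 * u2))"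
      using add_nonneg_pos add_pos_nonneg by blast
    then show ?thesis using assms(1) by simp
  qed
  finally show ?thesis .
qed

text \<open>The determinant of \<open>J - G\<close> and the \<open>(1,1)\<close> entry of its inverse.\<close>

definition D :: "complex \<Rightarrow> complex" where
  "D \<zeta> = (\<zeta> * \<phi> (R \<zeta>))\<^sup>2 + (\<i> + \<phi> (a * R \<zeta>)) * (\<i> - \<phi> (star a * R \<zeta>))"

definition F :: "complex \<Rightarrow> complex" where
  "F \<zeta> = - (\<zeta> * \<phi> (R \<zeta>)) / D \<zeta>"

text \<open>The vector \<open>v\<close> is \<open>k\<close> times the first column of the adjugate
  of \<open>J - G\<close>, so \<open>(J - G) v = (D \<zeta> * k, 0)\<close> and the form of
  \<open>J - G\<close> at \<open>v\<close> is \<open>cnj v1 * (D \<zeta> * k)\<close>. The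
  selfadjoint \<open>J\<close> contributes a real number and \<open>- G\<close> a positive imaginary
  part. The choice \<open>k = 1\<close> shows that \<open>D \<zeta>\<close> is nonzero;
  \<open>k = 1 / D \<zeta>\<close> makes \<open>v1 = F \<zeta>\<close> and gives the sign of its
  imaginary part.\<close>

lemma J_minus_G_form:
  assumes "Im \<zeta> > 0"
    and "v1 = - (\<zeta> * \<phi> (R \<zeta>)) * k" "v2 = (\<i> - \<phi> (star a * R \<zeta>)) * k" "k \<noteq> 0"
  shows "Im (cnj v1 * (D \<zeta> * k)) > 0"
proof -
  have g: "Im (\<zeta> * \<phi> (R \<zeta>)) < 0"
    using Im_G_form_neg[OF assms(1), of 1 0] by simp
  then have "v1 \<noteq> 0" using assms by auto
  define N where "N = cnj v1 * (\<zeta> * \<phi> (R \<zeta>) * v1 - \<phi> (a * R \<zeta>) * v2)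
           + cnj v2 * (\<zeta> * \<phi> (R \<zeta>) * v2 - \<phi> (star a * R \<zeta>) * v1)"
  have "Im N < 0"
    unfolding N_def using \<open>v1 \<noteq> 0\<close> by (intro Im_G_form_neg assms) auto
  moreover have "cnj v1 * (D \<zeta> * k) = (cnj v1 * (\<i> * v2) - cnj v2 * (\<i> * v1)) - N"
  proof -
    have "D \<zeta> * k = - (\<zeta> * \<phi> (R \<zeta>)) * v1 + (\<i> + \<phi> (a * R \<zeta>)) * v2"
      by (simp add: assms(2,3) D_def power2_eq_square algebra_simps)
    moreover have "(- \<i> + \<phi> (star a * R \<zeta>)) * v1 - \<zeta> * \<phi> (R \<zeta>) * v2 = 0"
      by (simp add: assms(2,3) algebra_simps)
    ultimately have "cnj v1 * (D \<zeta> * k) = cnj v1 * (- (\<zeta> * \<phi> (R \<zeta>)) * v1 + (\<i> + \<phi> (a * R \<zeta>)) * v2)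
        + cnj v2 * ((- \<i> + \<phi> (star a * R \<zeta>)) * v1 - \<zeta> * \<phi> (R \<zeta>) * v2)"
      by simp
    then show ?thesis by (simp add: N_def algebra_simps)
  qed
  moreover have "Im (cnj v1 * (\<i> * v2) - cnj v2 * (\<i> * v1)) = 0"
    by (simp add: algebra_simps)
  ultimately show ?thesis by simp
qed

lemma D_nonzero: "Im \<zeta> > 0 \<Longrightarrow> D \<zeta> \<noteq> 0"
  using J_minus_G_form[OF _ refl refl, of \<zeta> 1] by auto

lemma Im_F_neg:
  assumes "Im \<zeta> > 0"
  shows "Im (F \<zeta>) < 0"
proof -
  have "F \<zeta> = - (\<zeta> * \<phi> (R \<zeta>)) * (1 / D \<zeta>)" by (simp add: F_def)
  from J_minus_G_form[OF assms this refl] D_nonzero[OF assms] show ?thesis by simp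
qed

lemma H_eq:
  assumes "Im \<zeta> > 0"
  shows "H \<phi> x p (Bmat lam \<zeta>) $ 1 $ 1 = \<zeta> + complex_of_real p * F \<zeta>"
proof -
  let ?M = "Jmat - G \<phi> x (Bmat lam \<zeta>)"
  have M: "?M $ 1 $ 1 = - (\<zeta> * \<phi> (R \<zeta>))" "?M $ 2 $ 2 = - (\<zeta> * \<phi> (R \<zeta>))"
    "?M $ 1 $ 2 = \<i> + \<phi> (a * R \<zeta>)" "?M $ 2 $ 1 = - \<i> + \<phi> (star a * R \<zeta>)"
    using G_entries[OF assms] by (simp_all add: Jmat_def vector_2)
  have det: "?M $ 1 $ 1 * ?M $ 2 $ 2 - ?M $ 1 $ 2 * ?M $ 2 $ 1 = D \<zeta>"
    unfolding M by (simp add: D_def power2_eq_square algebra_simps)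
  have "matrix_inv ?M $ 1 $ 1 = F \<zeta>"
    using matrix_inv_2_11[of ?M] D_nonzero[OF assms] unfolding det unfolding M F_def by simp
  moreover have "Bmat lam \<zeta> $ 1 $ 1 = \<zeta>" by (simp add: Bmat_def vector_2)
  ultimately show ?thesis by (simp add: H_def) (simp add: scaleR_conv_of_real)
qed

section \<open>Analytic behaviour of \<open>F\<close>\<close>

lemma holomorphic_functional_R: "(\<lambda>\<zeta>. \<phi> (e * R \<zeta>)) holomorphic_on {\<zeta>. 0 < Im \<zeta>}"
proof -
  have "(\<lambda>z. \<phi> (e * resolvent (a * star a) z)) \<circ> (\<lambda>\<zeta>. \<zeta>\<^sup>2) holomorphic_on {\<zeta>. 0 < Im \<zeta>}"
    by (rule holomorphic_on_compose_gen[OF _ holomorphic_on_functional_resolvent[OF \<phi>_bounded subset_refl]])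
      (auto intro!: holomorphic_intros square_in_resolvent_set)
  then show ?thesis by (simp add: o_def R_def)
qed

lemma holomorphic_F: "F holomorphic_on {\<zeta>. 0 < Im \<zeta>}"
proof -
  have "(\<lambda>\<zeta>. \<phi> (R \<zeta>)) holomorphic_on {\<zeta>. 0 < Im \<zeta>}"
    using holomorphic_functional_R[of 1] by simp
  then show ?thesis
    using D_nonzero unfolding F_def[abs_def]
    by (intro holomorphic_intros) (auto simp: D_def[abs_def] intro!: holomorphic_intros holomorphic_functional_R)
qed

text \<open>All entries of \<open>G\<close> tend to 0, so \<open>D\<close> tends to the determinant
  \<open>\<i> * \<i> = - 1\<close> of \<open>J\<close>, while
  \<open>\<zeta>\<^sup>2 * \<phi> (R \<zeta>)\<close> tends to 1.\<close>

lemma F_at_infinity: "((\<lambda>\<zeta>. \<zeta> * F \<zeta>) \<longlongrightarrow> 1) at_infinity"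
proof -
  interpret bounded_linear \<phi>
    using \<phi>_bounded by (simp add: bounded_clinear_functional_def)
  have scale: "\<phi> (cscale k u) = k * \<phi> u" for k u
    using \<phi>_bounded by (simp add: bounded_clinear_functional_def clinear_functional_def)
  have sq: "filterlim (\<lambda>\<zeta>::complex. \<zeta>\<^sup>2) at_infinity at_infinity"
    by (intro filterlim_power_at_infinity filterlim_ident) auto
  have R0: "(R \<longlongrightarrow> 0) at_infinity"
    unfolding R_def[abs_def] by (rule filterlim_compose[OF resolvent_at_infinity(1) sq])
  have "((\<lambda>\<zeta>. cscale (\<zeta>\<^sup>2) (R \<zeta>)) \<longlongrightarrow> 1) at_infinity"
    unfolding R_def[abs_def] by (rule filterlim_compose[OF resolvent_at_infinity(2) sq])
  from tendsto[OF this] have m: "((\<lambda>\<zeta>. \<zeta>\<^sup>2 * \<phi> (R \<zeta>)) \<longlongrightarrow> 1) at_infinity"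
    using \<phi>_state by (simp add: scale state_def)
  have inv: "((\<lambda>\<zeta>::complex. inverse \<zeta>) \<longlongrightarrow> 0) at_infinity"
    by (rule tendsto_inverse_0)
  have eq: "inverse \<zeta> * (\<zeta>\<^sup>2 * \<phi> (R \<zeta>)) = \<zeta> * \<phi> (R \<zeta>)" for \<zeta>
    by (cases "\<zeta> = 0") (auto simp: power2_eq_square)
  have g: "((\<lambda>\<zeta>. \<zeta> * \<phi> (R \<zeta>)) \<longlongrightarrow> 0) at_infinity"
    using tendsto_mult[OF inv m] by (simp add: eq)
  have off: "((\<lambda>\<zeta>. \<phi> (e * R \<zeta>)) \<longlongrightarrow> 0) at_infinity" for e
    using tendsto[OF tendsto_mult[OF tendsto_const R0, of e]] by (simp add: zero)
  have "(D \<longlongrightarrow> 0\<^sup>2 + (\<i> + 0) * (\<i> - 0)) at_infinity"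
    unfolding D_def[abs_def] by (intro tendsto_intros g off)
  then have "((\<lambda>\<zeta>. - (\<zeta>\<^sup>2 * \<phi> (R \<zeta>)) / D \<zeta>) \<longlongrightarrow> - 1 / (- 1)) at_infinity"
    by (intro tendsto_intros m) auto
  then show ?thesis by (simp add: F_def power2_eq_square mult.assoc)
qed

text \<open>Here \<open>\<zeta>\<^sup>2\<close> is real, so \<open>R \<zeta>\<close> is selfadjoint
  and conjugation swaps \<open>\<phi> (a * R \<zeta>)\<close> with
  \<open>\<phi> (star a * R \<zeta>)\<close>. This fixes \<open>D \<zeta>\<close> and negates
  \<open>\<zeta> * \<phi> (R \<zeta>)\<close>.\<close>

lemma Re_F_imaginary_axis:
  assumes "\<delta> > 0"
  shows "Re (F (\<i> * of_real \<delta>)) = 0"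
proof -
  define \<zeta> where "\<zeta> = \<i> * of_real \<delta>"
  have \<zeta>: "Im \<zeta> > 0" "cnj \<zeta> = - \<zeta>" using assms by (simp_all add: \<zeta>_def)
  have "cnj (\<zeta>\<^sup>2) = \<zeta>\<^sup>2" using \<zeta> by simp
  then have R: "star (R \<zeta>) = R \<zeta>"
    using star_resolvent[OF square_in_resolvent_set[OF \<zeta>(1)]]
    by (simp add: R_def star_mult star_star)
  note cnj_\<phi> = state_star[OF \<phi>_state, symmetric]
  have m: "cnj (\<phi> (R \<zeta>)) = \<phi> (R \<zeta>)" "cnj (\<phi> (a * R \<zeta>)) = \<phi> (star a * R \<zeta>)"
    "cnj (\<phi> (star a * R \<zeta>)) = \<phi> (a * R \<zeta>)"
    using R R_inverse[OF \<zeta>(1)] by (simp_all add: cnj_\<phi> star_mult star_star)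
  have "cnj (D \<zeta>) = D \<zeta>"
    by (simp add: D_def m \<zeta>(2)) (simp add: algebra_simps)
  then have "cnj (F \<zeta>) = - F \<zeta>"
    by (simp add: F_def m \<zeta>(2))
  then have "Re (cnj (F \<zeta>)) = Re (- F \<zeta>)" by (rule arg_cong)
  then show ?thesis by (simp add: \<zeta>_def)
qed

end

theorem proposition1p3:
  fixes \<phi> :: "'a::cstar_algebra \<Rightarrow> complex"
    and x y :: 'a
    and p :: real
    and lam :: complex
  assumes "tracial_wstar_prob_space \<phi>"
    and "selfadjoint x"
    and "p > 0"
    and "free_poisson_element \<phi> p y"
    and "freely_independent \<phi> x y"
  shows "(\<exists>\<rho> :: real measure. prob_space \<rho> \<and> sets \<rho> = sets borel \<and>
            (\<forall>\<zeta>. Im \<zeta> > 0 \<longrightarrow>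
               H \<phi> x p (Bmat lam \<zeta>) $ 1 $ 1
                 = \<zeta> + complex_of_real p * (\<integral>t. 1 / (\<zeta> - complex_of_real t) \<partial>\<rho>)))
       \<and> (\<forall>\<delta>::real. \<delta> > 0 \<longrightarrow>
            Re (H \<phi> x p (Bmat lam (\<i> * complex_of_real \<delta>)) $ 1 $ 1) = 0)
       \<and> continuous_on {0<..}
            (\<lambda>\<delta>::real. Im (H \<phi> x p (Bmat lam (\<i> * complex_of_real \<delta>)) $ 1 $ 1) / \<delta>)
       \<and> strict_mono_on {0<..}
            (\<lambda>\<delta>::real. Im (H \<phi> x p (Bmat lam (\<i> * complex_of_real \<delta>)) $ 1 $ 1) / \<delta>)
       \<and> ((\<lambda>\<delta>::real. Im (H \<phi> x p (Bmat lam (\<i> * complex_of_real \<delta>)) $ 1 $ 1) / \<delta>)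
            \<longlongrightarrow> 1) at_top"
proof -
  interpret faithful_state_setting \<phi> x lam
  proof
    show "bounded_clinear_functional \<phi>"
      \<comment> \<open>A normal functional lies in a predual, whose members are bounded by
        definition.\<close>
      using assms(1) unfolding tracial_wstar_prob_space_def normal_functional_def is_predual_def by blast
  qed (use assms in \<open>simp_all add: tracial_wstar_prob_space_def\<close>)
  let ?H = "\<lambda>\<zeta>. H \<phi> x p (Bmat lam \<zeta>) $ 1 $ 1"
  obtain \<rho> :: "real measure" where \<rho>: "prob_space \<rho>" "sets \<rho> = sets borel"
    "\<And>z. 0 < Im z \<Longrightarrow> F z = (\<integral>t. 1 / (z - of_real t) \<partial>\<rho>)"
  proof (rule Nevanlinna_Cauchy_transform[OF holomorphic_F])
    show "Im (F z) \<le> 0" if "0 < Im z" for z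
      using Im_F_neg[OF that] by simp
    show "((\<lambda>z. z * F z) \<longlongrightarrow> 1) (inf at_infinity (principal {z. 0 < Im z}))"
      by (rule tendsto_mono[OF inf_le1 F_at_infinity])
  qed blast
  have H: "?H \<zeta> = \<zeta> + complex_of_real p * (\<integral>t. 1 / (\<zeta> - complex_of_real t) \<partial>\<rho>)"
    if "Im \<zeta> > 0" for \<zeta>
    using H_eq[OF that] \<rho>(3)[OF that] by simp
  have axis: "0 < Im (\<i> * complex_of_real \<delta>)" if "\<delta> \<in> {0<..}" for \<delta>
    using that by simp
  \<comment> \<open>Continuity is read off from the holomorphic \<open>F\<close>, before passing to
    the integral.\<close>
  have "continuous_on {0<..} (\<lambda>\<delta>. Im (\<i> * of_real \<delta> + of_real p * F (\<i> * of_real \<delta>)) / \<delta>)"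
    by (intro continuous_intros continuous_on_compose2[OF holomorphic_on_imp_continuous_on[OF holomorphic_F]]) auto
  then have "continuous_on {0<..} (\<lambda>\<delta>::real. Im (?H (\<i> * complex_of_real \<delta>)) / \<delta>)"
    by (rule continuous_on_cong[THEN iffD1, rotated -1]) (use axis H_eq in auto)
  moreover have "strict_mono_on {0<..} (\<lambda>\<delta>::real. Im (?H (\<i> * complex_of_real \<delta>)) / \<delta>)"
    using Im_Cauchy_transform_strict_mono[OF \<rho>(1,2) \<open>p > 0\<close>] H[OF axis]
    by (simp add: strict_mono_on_def)
  moreover have "((\<lambda>\<delta>::real. Im (?H (\<i> * complex_of_real \<delta>)) / \<delta>) \<longlongrightarrow> 1) at_top"
  proof (rule Lim_transform_eventually[OF Im_Cauchy_transform_tendsto[OF \<rho>(1,2) \<open>p > 0\<close>]])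
    show "\<forall>\<^sub>F \<delta> in at_top. Im (\<i> * of_real \<delta> + of_real p * (\<integral>t. 1 / (\<i> * of_real \<delta> - of_real t) \<partial>\<rho>)) / \<delta>
        = Im (?H (\<i> * complex_of_real \<delta>)) / \<delta>"
      using eventually_gt_at_top[of 0] by eventually_elim (use H axis in auto)
  qed
  moreover have "\<forall>\<delta>::real. \<delta> > 0 \<longrightarrow> Re (?H (\<i> * complex_of_real \<delta>)) = 0"
    using H_eq axis Re_F_imaginary_axis by simp
  ultimately show ?thesis
    using \<rho>(1,2) H by blast
qed

end
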